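(* Let $d \geq 3$ be an integer, and write $d=4m+r$ with integers $m,r$, where $0 \leq r \leq 3$. Then the following hold. (a) $M^{Bus}(d+1,d)= \dfrac{\kappa_d}{\binom{d}{\lfloor d/2\rfloor}}$, and $\mu_{d+1}^{Bus}(B) = M^{Bus}(d+1,d)$ whenever $B = \operatorname{conv} (S \cup (-S))$ for some ($d$-dimensional) regular simplex $S$ centered at the origin $o$. (b) If $0 \leq r \leq 1$, then $$M^{Bus}(d+2,d)= \frac{\kappa_d}{\binom{2m+1}{m} \cdot \binom{2m+r-1}{m}}.$$ Furthermore, $\mu_{d+2}^{Bus}(B) = M^{Bus}(d+2,d)$ whenever $B=\operatorname{conv} (S_1 \cup S_2 \cup (-S_1) \cup (-S_2))$, where $S_1$ and $S_2$ are regular simplices centered at $o$, of dimensions $2m+1$ and $2m+r-1$, respectively, lying in orthogonal linear subspaces of $\mathbb{R}^d$. (c) If $2 \leq r \leq 3$, then $$M^{Bus}(d+2,d)= \frac{\kappa_d}{\binom{2m+1}{m} \cdot \binom{2m+r-1}{m+1}}.$$ Furthermore, $\mu_{d+2}^{Bus}(B) = M^{Bus}(d+2,d)$ whenever $B=\operatorname{conv} (S_1 \cup S_2 \cup (-S_1) \cup (-S_2))$, where $S_1$ and $S_2$ are regular simplices centered at $o$, of dimensions $2m+1$ and $2m+r-1$, respectively, lying in orthogonal linear subspaces of $\mathbb{R}^d$.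
   Context: $\lambda_d$ denotes $d$-dimensional Lebesgue measure on $\mathbb{R}^d$, $\kappa_d=\lambda_d(\mathbf{B}^d)$ is the volume of the Euclidean unit ball $\mathbf{B}^d$, $o$ is the origin, and $\operatorname{conv}$ denotes convex hull. $\mathcal{K}^d_o$ is the family of $o$-symmetric convex bodies (compact convex sets with nonempty interior) in $\mathbb{R}^d$. A simplex is centered at $o$ if its centroid is $o$. For $B\in\mathcal{K}^d_o$, the Busemann volume of a set $S\subset\mathbb{R}^d$ in the normed space with unit ball $B$ is $\operatorname{vol}^{Bus}_B(S)=\frac{\kappa_d}{\lambda_d(B)}\lambda_d(S)$. For $n\ge d+1$, $$\mu_n^{Bus}(B)=\sup\{\operatorname{vol}_B^{Bus}(Q): Q \text{ is a convex polytope contained in } B \text{ with at most } n \text{ vertices}\},$$ and $M^{Bus}(n,d)=\sup\{\mu_n^{Bus}(B): B\in\mathcal{K}^d_o\}$. *)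

theory Defs
  imports "HOL-Analysis.Analysis"
begin

definition sym_convex_bodies :: "(real ^ 'd) set set" where
  "sym_convex_bodies =
     {B. compact B \<and> convex B \<and> interior B \<noteq> {} \<and> uminus ` B = B}"

definition kappa :: "'d::finite itself \<Rightarrow> real" where
  "kappa _ = measure lebesgue (cball (0 :: real ^ 'd) 1)"

definition vol_Bus :: "(real ^ 'd) set \<Rightarrow> (real ^ 'd) set \<Rightarrow> real" where
  "vol_Bus B S = kappa TYPE('d) / measure lebesgue B * measure lebesgue S"

definition vertices :: "'a::euclidean_space set \<Rightarrow> 'a set" where
  "vertices P = {v. v extreme_point_of P}"

definition mu_Bus :: "nat \<Rightarrow> (real ^ 'd) set \<Rightarrow> real" where
  "mu_Bus n B = Sup {vol_Bus B Q | Q. polytope Q \<and> Q \<subseteq> B \<and> card (vertices Q) \<le> n}"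

definition M_Bus :: "nat \<Rightarrow> 'd::finite itself \<Rightarrow> real" where
  "M_Bus n _ = Sup {mu_Bus n B | B :: (real ^ 'd) set. B \<in> sym_convex_bodies}"

definition regular_simplex :: "nat \<Rightarrow> 'a::euclidean_space set \<Rightarrow> bool" where
  "regular_simplex k S \<longleftrightarrow> int k simplex S \<and>
     (\<exists>l. \<forall>x\<in>vertices S. \<forall>y\<in>vertices S. x \<noteq> y \<longrightarrow> dist x y = l)"

text \<open>The mean of the vertices. For a simplex, the only case in which it is used, this is the
  centroid.\<close>

definition simplex_centroid :: "'a::euclidean_space set \<Rightarrow> 'a" where
  "simplex_centroid S = (\<Sum>v\<in>vertices S. v) /\<^sub>R real (card (vertices S))"

definition in_orthogonal_subspaces :: "'a::euclidean_space set \<Rightarrow> 'a set \<Rightarrow> bool" where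
  "in_orthogonal_subspaces S T \<longleftrightarrow>
     (\<exists>U V. subspace U \<and> subspace V \<and> (\<forall>u\<in>U. \<forall>v\<in>V. orthogonal u v) \<and> S \<subseteq> U \<and> T \<subseteq> V)"

text \<open>The suprema in the definitions of \<^const>\<open>mu_Bus\<close> and \<^const>\<open>M_Bus\<close> are suprema of nonempty
  bounded sets of reals, hence genuine.\<close>

lemma vol_Bus_le_kappa:
  fixes B Q :: "(real ^ 'd) set"
  assumes "B \<in> sym_convex_bodies" "polytope Q" "Q \<subseteq> B"
  shows "vol_Bus B Q \<le> kappa TYPE('d)"
proof -
  have B: "B \<in> lmeasurable"
    using assms by (simp add: sym_convex_bodies_def lmeasurable_compact)
  have "Q \<in> sets lebesgue"
    using assms by (simp add: polytope_imp_compact lmeasurable_compact fmeasurableD)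
  then have le: "measure lebesgue Q \<le> measure lebesgue B"
    using B assms by (intro measure_mono_fmeasurable) auto
  have k: "0 \<le> kappa TYPE('d)"
    by (simp add: kappa_def)
  show ?thesis
  proof (cases "measure lebesgue B = 0")
    case False
    then have "0 < measure lebesgue B"
      by (simp add: zero_less_measure_iff)
    then show ?thesis
      using mult_left_mono[OF le k] by (simp add: vol_Bus_def field_simps)
  qed (simp add: vol_Bus_def k)
qed

lemma mu_Bus_set_nonempty:
  "{vol_Bus B Q | Q. polytope Q \<and> Q \<subseteq> B \<and> card (vertices Q) \<le> n} \<noteq> {}"
proof -
  have "polytope ({} :: (real ^ 'd) set) \<and> {} \<subseteq> B \<and> card (vertices ({} :: (real ^ 'd) set)) \<le> n"
    for B :: "(real ^ 'd) set"
    by (auto simp: vertices_def extreme_point_of_def polytope_def)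
  then show ?thesis by blast
qed

lemma mu_Bus_set_bdd_above:
  assumes "B \<in> sym_convex_bodies"
  shows "bdd_above {vol_Bus B Q | Q. polytope Q \<and> Q \<subseteq> B \<and> card (vertices Q) \<le> n}"
  using vol_Bus_le_kappa[OF assms] by (force intro: bdd_aboveI)

lemma M_Bus_set_nonempty:
  "{mu_Bus n B | B :: (real ^ 'd) set. B \<in> sym_convex_bodies} \<noteq> {}"
proof -
  have "uminus ` cball (0 :: real ^ 'd) 1 = cball 0 1"
    using cball_scale[of "-1" "0 :: real ^ 'd" 1] by simp
  then have "cball 0 1 \<in> (sym_convex_bodies :: (real ^ 'd) set set)"
    by (simp add: sym_convex_bodies_def)
  then show ?thesis by blast
qed

lemma M_Bus_set_bdd_above:
  "bdd_above {mu_Bus n B | B :: (real ^ 'd) set. B \<in> sym_convex_bodies}"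
proof (rule bdd_aboveI)
  fix x assume "x \<in> {mu_Bus n B | B :: (real ^ 'd) set. B \<in> sym_convex_bodies}"
  then obtain B :: "(real ^ 'd) set" where "x = mu_Bus n B" "B \<in> sym_convex_bodies"
    by blast
  then show "x \<le> kappa TYPE('d)"
    unfolding mu_Bus_def
    by (auto intro!: cSup_least[OF mu_Bus_set_nonempty] vol_Bus_le_kappa)
qed

end

theory Submission
  imports Defs
begin

text \<open>Let \<open>Q = conv {p\<^sub>1, \<dots>, p\<^sub>n}\<close>. A symmetric body containing \<open>Q\<close> contains \<open>K = conv {\<plusminus>p\<^sub>1, \<dots>, \<plusminus>p\<^sub>n}\<close>,
  so one has to minimise \<open>vol K / vol Q\<close>. Reflecting along \<open>p\<^sub>i - p\<^sub>j\<close> and exchanging the two points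
  gives a shadow system from \<open>K\<close> to a congruent copy of itself. By convexity of the volume along
  shadow systems, stopping in between does not increase \<open>vol K\<close>, and its effect on the linear relations
  among the points is to move their \<open>i\<close>-th and \<open>j\<close>-th coefficients towards each other.

  For \<open>n = d + 1\<close>, finitely many steps make the unique relation constant, so that the points sum
  to zero. For \<open>n = d + 2\<close>, split the points into two blocks according to the sign of their affine
  (Radon) relation; steps inside the blocks make all relations constant on both blocks, so that each block
  sums to zero. The volume of \<open>Q\<close> is tracked through simplices whose vertices include both moving points;
  these keep their volume. In the final position, shifting coefficients by block medians dissects \<open>K\<close> into
  \<open>(k choose \<lfloor>k/2\<rfloor>) (l choose \<lfloor>l/2\<rfloor>)\<close> times as many simplices as \<open>Q\<close>, where the blocks have \<open>k + 1\<close>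
  and \<open>l + 1\<close> points and \<open>k + l = d\<close>; it remains to minimise over \<open>k\<close>.\<close>

section \<open>Shears and shadow systems\<close>

text \<open>For \<open>d + 2\<close> points the obstacle is that averaging over a block controls
  only the simplices containing that whole block, not the polytope itself. The Radon relation
  resolves this: dropping a point of the negative block leaves a simplex that contains the other
  block, and vice versa, and either family of simplices accounts for the volume of the polytope. One
  family is tracked while the first block is averaged, the other while the second is. In between one
  switches families: simplex volumes are proportional to the absolute Radon coefficients of the
  omitted points, so the two totals agree.

  The position of the origin has to be carried along too. Hence a second relation, with coefficient
  sum 1, is averaged together with the Radon relation: the latter equates the two block means, the
  former makes their common value zero. For \<open>d + 1\<close> points the origin itself is
  adjoined as a one-point block, so that both cases end in the same kind of balanced
  configuration.\<close>

lemma emeasure_fiber: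
  fixes K :: "'a::euclidean_space set"
  assumes [measurable]: "K \<in> sets borel"
  shows "emeasure lborel {s::real. y + s *\<^sub>R u \<in> K} = (\<integral>\<^sup>+s. indicator K (y + s *\<^sub>R u) \<partial>lborel)"
proof -
  have "{s::real. y + s *\<^sub>R u \<in> K} \<in> sets lborel"
    using measurable_sets[of "\<lambda>s::real. y + s *\<^sub>R u" borel borel K] by (simp add: vimage_def)
  moreover have "indicator K (y + s *\<^sub>R u) = (indicator {s::real. y + s *\<^sub>R u \<in> K} s :: ennreal)" for s
    by (simp add: indicator_def)
  ultimately show ?thesis
    by (simp only: nn_integral_indicator)
qed

lemma borel_measurable_emeasure_fiber [measurable]:
  fixes K :: "'a::euclidean_space set"
  assumes [measurable]: "K \<in> sets borel"
  shows "(\<lambda>y. emeasure lborel {s::real. y + s *\<^sub>R u \<in> K}) \<in> borel_measurable borel"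
  unfolding emeasure_fiber[OF assms] by measurable

text \<open>Cutting with a slab of width 1 normalises the integral over lines parallel to \<open>u\<close>, which avoids
  splitting the space as a product with the orthogonal complement of \<open>u\<close>.\<close>

lemma emeasure_lborel_fibers:
  fixes K :: "'a::euclidean_space set"
  assumes K: "closed K" and u: "norm u = 1"
  shows "emeasure lborel K =
    (\<integral>\<^sup>+y. indicator {y. 0 \<le> y \<bullet> u \<and> y \<bullet> u \<le> 1} y * emeasure lborel {s::real. y + s *\<^sub>R u \<in> K} \<partial>lborel)"
proof -
  let ?C = "{y::'a. 0 \<le> y \<bullet> u \<and> y \<bullet> u \<le> 1}"
  have C [measurable]: "?C \<in> sets borel"
    by (intro borel_closed closed_Collect_conj closed_Collect_le continuous_intros)
  have K' [measurable]: "K \<in> sets borel"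
    using K by simp
  have uu: "u \<bullet> u = 1"
    using u by (simp add: norm_eq_1)
  \<comment> \<open>This is why width 1 is chosen: in the double integral below, each point of
    \<open>K\<close> is counted for a parameter set of length exactly 1.\<close>
  have len: "emeasure lborel {s::real. x - s *\<^sub>R u \<in> ?C} = 1" for x
  proof -
    have "{s::real. x - s *\<^sub>R u \<in> ?C} = {x \<bullet> u - 1 .. x \<bullet> u}"
      by (auto simp: inner_diff_left uu)
    then show ?thesis by simp
  qed
  have "(\<integral>\<^sup>+y. indicator ?C y * emeasure lborel {s::real. y + s *\<^sub>R u \<in> K} \<partial>lborel)
     = (\<integral>\<^sup>+y. (\<integral>\<^sup>+s. indicator ?C y * indicator K (y + s *\<^sub>R u) \<partial>lborel) \<partial>lborel)"
  proof (rule nn_integral_cong)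
    fix y :: 'a
    have "emeasure lborel {s::real. y + s *\<^sub>R u \<in> K} = (\<integral>\<^sup>+s. indicator K (y + s *\<^sub>R u) \<partial>lborel)"
      by (rule emeasure_fiber) (use K in auto)
    then show "indicator ?C y * emeasure lborel {s::real. y + s *\<^sub>R u \<in> K}
       = (\<integral>\<^sup>+s. indicator ?C y * indicator K (y + s *\<^sub>R u) \<partial>lborel)"
      by (simp add: nn_integral_cmult)
  qed
  also have "\<dots> = (\<integral>\<^sup>+s. (\<integral>\<^sup>+y. indicator ?C y * indicator K (y + s *\<^sub>R u) \<partial>lborel) \<partial>lborel)"
    by (rule pair_sigma_finite.Fubini') (auto intro: pair_sigma_finite.intro sigma_finite_lborel)
  also have "\<dots> = (\<integral>\<^sup>+s. (\<integral>\<^sup>+x. indicator ?C (x - s *\<^sub>R u) * indicator K x \<partial>lborel) \<partial>lborel)"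
  proof (rule nn_integral_cong)
    fix s :: real
    have "(\<integral>\<^sup>+x. indicator ?C (x - s *\<^sub>R u) * indicator K x \<partial>lborel)
       = (\<integral>\<^sup>+x. indicator ?C (x - s *\<^sub>R u) * indicator K x \<partial>distr lborel borel ((+) (s *\<^sub>R u)))"
      by (simp only: lborel_distr_plus)
    also have "\<dots> = (\<integral>\<^sup>+y. indicator ?C y * indicator K (y + s *\<^sub>R u) \<partial>lborel)"
      by (subst nn_integral_distr) (auto simp: add.commute)
    finally show "(\<integral>\<^sup>+y. indicator ?C y * indicator K (y + s *\<^sub>R u) \<partial>lborel)
      = (\<integral>\<^sup>+x. indicator ?C (x - s *\<^sub>R u) * indicator K x \<partial>lborel)" by simp
  qed
  also have "\<dots> = (\<integral>\<^sup>+x. (\<integral>\<^sup>+s. indicator ?C (x - s *\<^sub>R u) * indicator K x \<partial>lborel) \<partial>lborel)"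
    by (rule pair_sigma_finite.Fubini') (auto intro: pair_sigma_finite.intro sigma_finite_lborel)
  also have "\<dots> = (\<integral>\<^sup>+x. indicator K x \<partial>lborel)"
  proof (rule nn_integral_cong)
    fix x :: 'a
    have "(\<integral>\<^sup>+s. indicator ?C (x - s *\<^sub>R u) \<partial>lborel) = emeasure lborel {s::real. x - s *\<^sub>R u \<in> ?C}"
      using emeasure_fiber[OF C, of x "- u"] by simp
    with len[of x] show "(\<integral>\<^sup>+s. indicator ?C (x - s *\<^sub>R u) * indicator K x \<partial>lborel) = indicator K x"
      by (subst nn_integral_multc) auto
  qed
  finally show ?thesis
    by simp
qed

lemma measure_lebesgue_compact:
  fixes K :: "'a::euclidean_space set"
  assumes "compact K"
  shows "ennreal (measure lebesgue K) = emeasure lborel K"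
proof -
  have "emeasure lborel K < \<infinity>"
    using assms by (intro emeasure_bounded_finite compact_imp_bounded)
  then show ?thesis
    using assms by (simp add: measure_def emeasure_completion compact_imp_closed)
qed

text \<open>Every line parallel to \<open>u\<close> is mapped into itself with the same slope
  \<open>1 + g u\<close>, so all fibre lengths scale by \<open>\<bar>1 + g u\<bar>\<close>. If the
  slope is zero, the image lies in a hyperplane. Fibres need a unit direction, hence
  \<open>v\<close> and the rescaled functional \<open>h\<close>.\<close>

lemma measure_shear_image:
  fixes K :: "'a::euclidean_space set" and g :: "'a \<Rightarrow> real"
  assumes K: "compact K" and g: "linear g"
  shows "measure lebesgue ((\<lambda>x. x + (g x + k) *\<^sub>R u) ` K) = \<bar>1 + g u\<bar> * measure lebesgue K"
proof (cases "u = 0")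
  case True
  then show ?thesis using linear_0[OF g] by simp
next
  case False
  define v where "v = u /\<^sub>R norm u"
  define h where "h x = norm u * g x" for x
  have h: "linear h" unfolding h_def
    using linear_compose_scale_right[OF g, of "norm u"] by simp
  let ?f = "\<lambda>x. x + (h x + norm u * k) *\<^sub>R v"
  have f_eq: "(\<lambda>x. x + (g x + k) *\<^sub>R u) = ?f"
    using False by (auto simp: v_def h_def fun_eq_iff algebra_simps)
  have hv: "h v = g u" using False g by (simp add: h_def v_def linear_cmul)
  have v: "norm v = 1" using False by (simp add: v_def)
  have "compact (?f ` K)"
    by (intro compact_continuous_image K continuous_intros linear_continuous_on linear_conv_bounded_linear[THEN iffD1] h)
  show ?thesis
  proof (cases "1 + g u = 0")
    case True
    have gu: "g u = -1"
      using True by simp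
    have "?f ` K \<subseteq> {x. h x = - norm u * k}"
      by (auto simp: linear_add[OF h] linear_cmul[OF h] hv gu algebra_simps)
    moreover have "negligible {x. h x = - norm u * k}"
    proof -
      have "h x = adjoint h 1 \<bullet> x" for x
        using adjoint_works[OF h, of x 1] by (simp add: inner_commute)
      moreover have "adjoint h 1 \<noteq> 0"
        using True hv calculation[of v] by auto
      ultimately show ?thesis
        using negligible_hyperplane[of "adjoint h 1" "- norm u * k"] by simp
    qed
    ultimately have "negligible (?f ` K)"
      using negligible_subset by blast
    then show ?thesis
      using True unfolding f_eq by (simp add: negligible_imp_measure0)
  next
    case False
    let ?c = "1 + g u"
    have fib: "emeasure lborel {s. y + s *\<^sub>R v \<in> ?f ` K} = ennreal \<bar>?c\<bar> * emeasure lborel {s. y + s *\<^sub>R v \<in> K}" for y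
    proof -
      let ?d = "h y + norm u * k"
      have "{s. y + s *\<^sub>R v \<in> ?f ` K} = (\<lambda>s. ?d + ?c * s) ` {s. y + s *\<^sub>R v \<in> K}"
      proof (intro equalityI subsetI)
        fix s assume "s \<in> {s. y + s *\<^sub>R v \<in> ?f ` K}"
        then obtain x where x: "x \<in> K" "y + s *\<^sub>R v = ?f x" by auto
        define s' where "s' = s - (h x + norm u * k)"
        have x': "x = y + s' *\<^sub>R v" using x(2) by (simp add: s'_def algebra_simps)
        have "h x = h y + s' * g u"
          by (simp add: x' linear_add[OF h] linear_cmul[OF h] hv)
        moreover have "s = s' + (h x + norm u * k)"
          by (simp add: s'_def)
        ultimately have "s = s' + (h y + s' * g u + norm u * k)"
          by simp
        then have "s = ?d + ?c * s'"
          by (simp add: algebra_simps)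
        with x x' show "s \<in> (\<lambda>s. ?d + ?c * s) ` {s. y + s *\<^sub>R v \<in> K}" by blast
      next
        fix s assume "s \<in> (\<lambda>s. ?d + ?c * s) ` {s. y + s *\<^sub>R v \<in> K}"
        then obtain s' where s': "y + s' *\<^sub>R v \<in> K" "s = ?d + ?c * s'" by auto
        then have "y + s *\<^sub>R v = ?f (y + s' *\<^sub>R v)"
          by (simp add: linear_add[OF h] linear_cmul[OF h] hv algebra_simps)
        with s' show "s \<in> {s. y + s *\<^sub>R v \<in> ?f ` K}" by blast
      qed
      moreover have "closed {s. y + s *\<^sub>R v \<in> K}"
        using continuous_closed_vimage[of K "\<lambda>s. y + s *\<^sub>R v"] K
        by (auto simp: vimage_def compact_imp_closed intro!: continuous_intros)
      moreover have "closed {s. y + s *\<^sub>R v \<in> ?f ` K}"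
        using continuous_closed_vimage[of "?f ` K" "\<lambda>s. y + s *\<^sub>R v"] \<open>compact (?f ` K)\<close>
        by (auto simp: vimage_def compact_imp_closed intro!: continuous_intros)
      ultimately show ?thesis
        using emeasure_lebesgue_affine[of ?c ?d "{s. y + s *\<^sub>R v \<in> K}"]
        by (simp add: add.commute)
    qed
    have "closed K" using K by (rule compact_imp_closed)
    have [measurable]: "{y. 0 \<le> y \<bullet> v \<and> y \<bullet> v \<le> 1} \<in> sets borel" "K \<in> sets borel"
      using \<open>closed K\<close> by (auto intro!: borel_closed closed_Collect_conj closed_Collect_le continuous_intros)
    have "emeasure lborel (?f ` K) = ennreal \<bar>?c\<bar> * emeasure lborel K"
      using \<open>compact (?f ` K)\<close> \<open>closed K\<close>
      by (simp add: emeasure_lborel_fibers[OF _ v] compact_imp_closed fib mult.left_commute nn_integral_cmult)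
    then have "ennreal (measure lebesgue (?f ` K)) = ennreal (\<bar>?c\<bar> * measure lebesgue K)"
      by (simp only: measure_lebesgue_compact[OF \<open>compact (?f ` K)\<close>] measure_lebesgue_compact[OF K]
          ennreal_mult abs_ge_zero measure_nonneg)
    then show ?thesis
      unfolding f_eq by (subst (asm) ennreal_inj) auto
  qed
qed

text \<open>Coefficients belong to indices, not to points. Moving points may collide, and a family
  with repetitions must still keep one coefficient per index.\<close>

lemma convex_hull_image_eq:
  fixes p :: "'i \<Rightarrow> 'a::real_vector"
  assumes J: "finite J"
  shows "convex hull (p ` J) = {\<Sum>m\<in>J. c m *\<^sub>R p m | c. (\<forall>m\<in>J. 0 \<le> c m) \<and> sum c J = 1}" (is "_ = ?R")
proof
  show "convex hull (p ` J) \<subseteq> ?R"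
  proof (rule hull_minimal)
    show "p ` J \<subseteq> ?R"
    proof
      fix x assume "x \<in> p ` J"
      then obtain m where m: "m \<in> J" "x = p m" by auto
      then have "x = (\<Sum>n\<in>J. (if n = m then 1 else 0) *\<^sub>R p n)"
        using J by (simp add: if_distrib[of "\<lambda>c. c *\<^sub>R _"] cong: if_cong)
      with m J show "x \<in> ?R"
        by (auto intro!: exI[of _ "\<lambda>n. if n = m then 1 else 0"])
    qed
    show "convex ?R"
    proof (rule convexI, clarify)
      fix u v :: real and c e :: "'i \<Rightarrow> real"
      assume uv: "0 \<le> u" "0 \<le> v" "u + v = 1"
        and c: "\<forall>m\<in>J. 0 \<le> c m" "sum c J = 1" and e: "\<forall>m\<in>J. 0 \<le> e m" "sum e J = 1"
      show "\<exists>f. u *\<^sub>R (\<Sum>m\<in>J. c m *\<^sub>R p m) + v *\<^sub>R (\<Sum>m\<in>J. e m *\<^sub>R p m) = (\<Sum>m\<in>J. f m *\<^sub>R p m)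
          \<and> (\<forall>m\<in>J. 0 \<le> f m) \<and> sum f J = 1"
        using uv c e
        by (intro exI[of _ "\<lambda>m. u * c m + v * e m"])
          (auto simp: scaleR_sum_right scaleR_add_left sum.distrib sum_distrib_left[symmetric])
    qed
  qed
  show "?R \<subseteq> convex hull (p ` J)"
  proof clarify
    fix c :: "'i \<Rightarrow> real" assume "\<forall>m\<in>J. 0 \<le> c m" "sum c J = 1"
    then show "(\<Sum>m\<in>J. c m *\<^sub>R p m) \<in> convex hull (p ` J)"
      using J by (intro convex_sum) (auto simp: hull_inc)
  qed
qed

lemma compact_convex_hull_image:
  fixes p :: "'i \<Rightarrow> 'a::euclidean_space"
  shows "finite J \<Longrightarrow> compact (convex hull (p ` J))"
  by (simp add: finite_imp_compact_convex_hull)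

text \<open>On each line parallel to \<open>u\<close>, the fibre at time \<open>t\<close> lies in
  the Minkowski combination of the fibres at times 0 and 1, so fibre length is at most the
  corresponding combination of lengths. Integrating over all lines gives the claim.\<close>

lemma shadow_system_measure_convex:
  fixes p q :: "'i \<Rightarrow> 'a::euclidean_space" and t :: real
  assumes J: "finite J" and t: "0 \<le> t" "t \<le> 1"
    and par: "\<And>m. m \<in> J \<Longrightarrow> q m - p m \<in> span {u}"
  shows "measure lebesgue (convex hull ((\<lambda>m. (1 - t) *\<^sub>R p m + t *\<^sub>R q m) ` J)) \<le>
    (1 - t) * measure lebesgue (convex hull (p ` J)) + t * measure lebesgue (convex hull (q ` J))"
proof -
  \<comment> \<open>If \<open>u = 0\<close>, no point moves and any unit vector serves as
    direction.\<close>
  define v where "v = (if u = 0 then SOME i. i \<in> Basis else u /\<^sub>R norm u)"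
  have v: "norm v = 1"
    using someI_ex[of "\<lambda>i. i \<in> (Basis::'a set)"] nonempty_Basis by (auto simp: v_def)
  have "\<exists>l. q m = p m + l *\<^sub>R v" if m: "m \<in> J" for m
  proof -
    obtain l where l: "q m - p m = l *\<^sub>R u"
      using par[OF m] by (auto simp: span_singleton)
    show ?thesis
      using l by (intro exI[of _ "l * norm u"]) (auto simp: v_def algebra_simps)
  qed
  then obtain l where l: "\<And>m. m \<in> J \<Longrightarrow> q m = p m + l m *\<^sub>R v"
    by metis
  define r where "r s m = p m + (s * l m) *\<^sub>R v" for s m
  define K where "K s = convex hull (r s ` J)" for s
  have K0: "K 0 = convex hull (p ` J)" and K1: "K 1 = convex hull (q ` J)"
    using l by (auto simp: K_def r_def intro!: arg_cong[of _ _ "(hull) convex"])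
  have Kt: "K t = convex hull ((\<lambda>m. (1 - t) *\<^sub>R p m + t *\<^sub>R q m) ` J)"
    unfolding K_def r_def
    by (intro arg_cong[of _ _ "(hull) convex"] image_cong refl) (simp add: l algebra_simps)
  have comp: "compact (K s)" for s
    by (simp add: K_def J compact_convex_hull_image)
  define F where "F s y = {x::real. y + x *\<^sub>R v \<in> K s}" for s y
  have rep: "\<exists>c. y + x *\<^sub>R v = (\<Sum>m\<in>J. c m *\<^sub>R r s m) \<and> (\<forall>m\<in>J. 0 \<le> c m) \<and> sum c J = 1"
    if "x \<in> F s y" for s y x
    using that by (auto simp: F_def K_def convex_hull_image_eq[OF J])
  have len: "emeasure lborel (F t y) \<le> ennreal (1 - t) * emeasure lborel (F 0 y) + ennreal t * emeasure lborel (F 1 y)" for y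
  proof (cases "F t y = {}")
    case False
    \<comment> \<open>Freezing the coefficients \<open>c\<close> and varying the time, the point
      slides along \<open>v\<close> with constant speed \<open>g\<close>. So it stays on its line
      and meets the hulls at times 0 and 1.\<close>
    have split: "\<exists>a b. a \<in> F 0 y \<and> b \<in> F 1 y \<and> x = (1 - t) * a + t * b" if x: "x \<in> F t y" for x
    proof -
      obtain c where c: "y + x *\<^sub>R v = (\<Sum>m\<in>J. c m *\<^sub>R r t m)" "\<forall>m\<in>J. 0 \<le> c m" "sum c J = 1"
        using rep[OF x] by blast
      define g where "g = (\<Sum>m\<in>J. c m * l m)"
      have rs: "(\<Sum>m\<in>J. c m *\<^sub>R r s m) = (\<Sum>m\<in>J. c m *\<^sub>R p m) + (s * g) *\<^sub>R v" for s
        by (simp add: r_def g_def scaleR_add_right sum.distrib scaleR_sum_left sum_distrib_left mult_ac)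
      have "(\<Sum>m\<in>J. c m *\<^sub>R r s m) \<in> K s" for s
        using c by (auto simp: K_def convex_hull_image_eq[OF J])
      moreover have "y + (x - t * g + s * g) *\<^sub>R v = (\<Sum>m\<in>J. c m *\<^sub>R r s m)" for s
        using c(1) by (simp add: rs algebra_simps)
      ultimately have "x - t * g + s * g \<in> F s y" for s
        by (simp add: F_def)
      from this[of 0] this[of 1] show ?thesis
        by (intro exI[of _ "x - t * g"] exI[of _ "x - t * g + g"]) (simp add: algebra_simps)
    qed
    \<comment> \<open>Fibres are compact and convex, hence closed intervals. Once they are known to
      be nonempty, lengths are differences of endpoints and add under Minkowski combination.\<close>
    have int: "\<exists>a b. F s y = {a..b}" for s
    proof -
      have "F s y = (\<lambda>x. (x - y) \<bullet> v) ` (K s \<inter> range (\<lambda>x. y + x *\<^sub>R v))"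
        using v by (force simp: F_def norm_eq_1 image_iff)
      moreover have "closed (range (\<lambda>x. y + x *\<^sub>R v))"
      proof -
        have "range (\<lambda>x. y + x *\<^sub>R v) = (+) y ` span {v}"
          by (auto simp: span_singleton)
        then show ?thesis by (simp add: closed_translation)
      qed
      ultimately have "compact (F s y)"
        using comp[of s] by (auto intro!: compact_continuous_image continuous_intros compact_Int_closed)
      moreover have "convex (F s y)"
      proof (rule convexI)
        fix a b u w :: real
        assume "a \<in> F s y" "b \<in> F s y" "0 \<le> u" "0 \<le> w" "u + w = 1"
        moreover have "convex (K s)" by (simp add: K_def)
        moreover have "y + (u * a + w * b) *\<^sub>R v = u *\<^sub>R (y + a *\<^sub>R v) + w *\<^sub>R (y + b *\<^sub>R v)"
          using \<open>u + w = 1\<close> by (simp add: algebra_simps flip: scaleR_add_left)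
        ultimately show "u *\<^sub>R a + w *\<^sub>R b \<in> F s y"
          by (auto simp: F_def convex_def)
      qed
      ultimately show ?thesis
        using connected_compact_interval_1 convex_connected by blast
    qed
    obtain a0 b0 a1 b1 where ab: "F 0 y = {a0..b0}" "F 1 y = {a1..b1}"
      using int by metis
    have ne: "a0 \<le> b0" "a1 \<le> b1"
      using split False ab by fastforce+
    have "F t y \<subseteq> {(1 - t) * a0 + t * a1 .. (1 - t) * b0 + t * b1}"
      using split ab t by (auto intro!: add_mono mult_left_mono) (fastforce intro!: add_mono mult_left_mono)+
    then have "emeasure lborel (F t y) \<le> emeasure lborel {(1 - t) * a0 + t * a1 .. (1 - t) * b0 + t * b1}"
      by (intro emeasure_mono) auto
    also have "\<dots> = ennreal ((1 - t) * (b0 - a0) + t * (b1 - a1))"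
    proof -
      have "(1 - t) * a0 + t * a1 \<le> (1 - t) * b0 + t * b1"
        using ne t by (intro add_mono mult_left_mono) auto
      then show ?thesis
        by (subst emeasure_lborel_Icc) (auto simp: algebra_simps)
    qed
    also have "\<dots> = ennreal (1 - t) * emeasure lborel (F 0 y) + ennreal t * emeasure lborel (F 1 y)"
      using ne t by (simp add: ab ennreal_mult ennreal_plus)
    finally show ?thesis .
  qed simp
  let ?C = "indicator {y. 0 \<le> y \<bullet> v \<and> y \<bullet> v \<le> 1} :: 'a \<Rightarrow> ennreal"
  have cl: "closed (K s)" for s using comp compact_imp_closed by blast
  have [measurable]: "{y. 0 \<le> y \<bullet> v \<and> y \<bullet> v \<le> 1} \<in> sets borel"
    by (auto intro!: borel_closed closed_Collect_conj closed_Collect_le continuous_intros)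
  have [measurable]: "(\<lambda>y. emeasure lborel (F s y)) \<in> borel_measurable borel" for s
    unfolding F_def by (rule borel_measurable_emeasure_fiber) (use cl in auto)
  have em: "emeasure lborel (K s) = (\<integral>\<^sup>+y. ?C y * emeasure lborel (F s y) \<partial>lborel)" for s
    unfolding F_def by (rule emeasure_lborel_fibers[OF cl v])
  have "emeasure lborel (K t) \<le> (\<integral>\<^sup>+y. ?C y * (ennreal (1 - t) * emeasure lborel (F 0 y) + ennreal t * emeasure lborel (F 1 y)) \<partial>lborel)"
    unfolding em by (intro nn_integral_mono mult_left_mono len) auto
  also have "\<dots> = (\<integral>\<^sup>+y. ennreal (1 - t) * (?C y * emeasure lborel (F 0 y)) + ennreal t * (?C y * emeasure lborel (F 1 y)) \<partial>lborel)"
    by (intro nn_integral_cong) (simp add: distrib_left mult_ac)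
  also have "\<dots> = ennreal (1 - t) * emeasure lborel (K 0) + ennreal t * emeasure lborel (K 1)"
    by (simp add: em nn_integral_add nn_integral_cmult)
  also have "\<dots> = ennreal ((1 - t) * measure lebesgue (K 0) + t * measure lebesgue (K 1))"
    using t by (simp add: measure_lebesgue_compact[OF comp, symmetric] ennreal_mult ennreal_plus)
  finally have "ennreal (measure lebesgue (K t)) \<le> \<dots>"
    by (simp add: measure_lebesgue_compact[OF comp])
  then have "measure lebesgue (K t) \<le> (1 - t) * measure lebesgue (K 0) + t * measure lebesgue (K 1)"
    using t by (subst (asm) ennreal_le_iff) auto
  then show ?thesis
    by (simp add: K0 K1 Kt)
qed

section \<open>Averaging linear relations\<close>

text \<open>Positive volume serves as the general position hypothesis throughout; degenerate
  simplices satisfy the desired inequalities trivially and are split off by cases.\<close>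

lemma nondegenerate_simplex:
  fixes p :: "'i \<Rightarrow> 'a::euclidean_space"
  assumes J: "finite J" "card J = Suc DIM('a)" and pos: "measure lebesgue (convex hull (p ` J)) \<noteq> 0"
  shows "inj_on p J" "\<not> affine_dependent (p ` J)"
proof -
  have "measure lebesgue (interior (convex hull (p ` J))) = measure lebesgue (convex hull (p ` J))"
    using J by (intro measure_interior negligible_convex_frontier compact_imp_bounded)
      (auto simp: compact_convex_hull_image)
  with pos have int: "interior (convex hull (p ` J)) \<noteq> {}"
    by auto
  then have "\<not> card (p ` J) \<le> DIM('a)"
    using J empty_interior_convex_hull[of "p ` J"] by auto
  with J have card: "card (p ` J) = Suc DIM('a)"
    using card_image_le[of J p] by auto
  then show "inj_on p J"
    using J by (simp add: eq_card_imp_inj_on)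
  show "\<not> affine_dependent (p ` J)"
    using int card by (simp add: interior_convex_hull_eq_empty)
qed

text \<open>Taking differences to one vertex turns affine into linear independence, where values
  extend freely. The functional is used to recognise a prescribed motion of vertices as a
  shear.\<close>

lemma affine_functional_exists:
  fixes p :: "'i \<Rightarrow> 'a::euclidean_space" and w :: "'i \<Rightarrow> real"
  assumes inj: "inj_on p J" and ind: "\<not> affine_dependent (p ` J)"
  shows "\<exists>g k. linear g \<and> (\<forall>m\<in>J. g (p m) + k = w m)"
proof (cases "J = {}")
  case True
  then show ?thesis using linear_zero by auto
next
  case False
  then obtain c where c: "c \<in> J" by auto
  let ?B = "(\<lambda>x. - p c + x) ` (p ` J - {p c})"
  have "independent ?B"
    using ind affine_dependent_iff_dependent2[of "p c" "p ` J"] c by auto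
  then obtain g where g: "linear g" "\<And>x. x \<in> ?B \<Longrightarrow> g x = w (inv_into J p (x + p c)) - w c"
    using linear_independent_extend[of ?B "\<lambda>x. w (inv_into J p (x + p c)) - w c"] by blast
  have "g (p m) + (w c - g (p c)) = w m" if m: "m \<in> J" for m
  proof (cases "m = c")
    case False
    then have "- p c + p m \<in> ?B"
      using m c inj by (auto simp: inj_on_def)
    then have "g (- p c + p m) = w m - w c"
      using g(2)[of "- p c + p m"] m inj by simp
    then show ?thesis
      using linear_diff[OF g(1), of "p m" "p c"] by (simp add: algebra_simps)
  qed simp
  with g(1) show ?thesis by blast
qed

text \<open>A displacement along \<open>u\<close> that is affine in the position extends from the
  vertices to the whole hull. Reflections, the motion of a simplex in a shadow system, the exchange
  of a vertex and the negation of a vertex are all of this form.\<close>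

lemma measure_convex_hull_shear:
  fixes p q :: "'i \<Rightarrow> 'a::euclidean_space"
  assumes J: "finite J" and g: "linear g"
    and q: "\<And>m. m \<in> J \<Longrightarrow> q m = p m + (g (p m) + k) *\<^sub>R u"
  shows "measure lebesgue (convex hull (q ` J)) = \<bar>1 + g u\<bar> * measure lebesgue (convex hull (p ` J))"
proof -
  let ?f = "\<lambda>x. x + g x *\<^sub>R u"
  have f: "linear ?f"
    using g by (auto intro!: linearI simp: linear_add linear_cmul algebra_simps)
  have "q ` J = (+) (k *\<^sub>R u) ` ?f ` p ` J"
    using q by (force simp: image_iff algebra_simps)
  then have "convex hull (q ` J) = (+) (k *\<^sub>R u) ` ?f ` (convex hull (p ` J))"
    by (simp only: convex_hull_translation convex_hull_linear_image[OF f])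
  also have "\<dots> = (\<lambda>x. x + (g x + k) *\<^sub>R u) ` (convex hull (p ` J))"
    by (simp add: image_image algebra_simps)
  finally show ?thesis
    using measure_shear_image[OF compact_convex_hull_image[OF J] g] by simp
qed

section \<open>Symmetric hulls and the reflection step\<close>

definition sym_hull :: "('i \<Rightarrow> 'a::euclidean_space) \<Rightarrow> 'i set \<Rightarrow> 'a set" where
  "sym_hull p I = convex hull (p ` I \<union> uminus ` p ` I)"

text \<open>Written as the hull of one signed indexed family, the symmetric hull is itself subject
  to shadow systems: \<open>- p m\<close> moves parallel to \<open>u\<close> whenever
  \<open>p m\<close> does.\<close>

lemma sym_hull_eq: "sym_hull p I = convex hull ((\<lambda>(m, s). s *\<^sub>R p m) ` (I \<times> {1, -1}))"
  unfolding sym_hull_def by (rule arg_cong[of _ _ "(hull) convex"]) force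

lemma compact_sym_hull: "finite I \<Longrightarrow> compact (sym_hull p I)"
  by (simp add: sym_hull_def finite_imp_compact_convex_hull)

definition relation :: "('i \<Rightarrow> 'a::euclidean_space) \<Rightarrow> 'i set \<Rightarrow> ('i \<Rightarrow> real) \<Rightarrow> bool" where
  "relation p I l \<longleftrightarrow> (\<Sum>m\<in>I. l m *\<^sub>R p m) = 0"

text \<open>With \<open>T\<close> the reflection along \<open>u = p i - p j\<close>, every point moves from \<open>p m\<close> towards
  \<open>T (p (\<sigma> m))\<close>, \<open>\<sigma>\<close> the transposition of \<open>i\<close> and \<open>j\<close>. All displacements are parallel to \<open>u\<close>, so this is a
  shadow system, and its endpoint is a congruent copy of the starting configuration.\<close>

lemma pair_averaging:
  fixes p :: "'i \<Rightarrow> 'a::euclidean_space"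
  assumes I: "finite I" and ij: "i \<in> I" "j \<in> I" and t: "0 \<le> t" "t \<le> 1"
  shows "\<exists>p'::'i \<Rightarrow> 'a. measure lebesgue (sym_hull p' I) \<le> measure lebesgue (sym_hull p I) \<and>
    (\<forall>l. relation p I l \<longrightarrow> relation p' I (\<lambda>m. (1 - t) * l m + t * l (Transposition.transpose i j m))) \<and>
    (\<forall>J. J \<subseteq> I \<and> i \<in> J \<and> j \<in> J \<and> card J = Suc DIM('a) \<longrightarrow>
        measure lebesgue (convex hull (p ` J)) \<le> measure lebesgue (convex hull (p' ` J)))"
proof -
  define u where "u = p i - p j"
  \<comment> \<open>The coefficient of the orthogonal reflection that negates \<open>u\<close>. If
    \<open>p i = p j\<close>, division by zero yields \<open>g = 0\<close>, so \<open>T\<close> is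
    the identity and the argument covers this case as well.\<close>
  define g where "g x = (- 2 / (u \<bullet> u)) * (x \<bullet> u)" for x
  have g: "linear g"
    by (auto intro!: linearI simp: g_def inner_add_left distrib_left)
  define T where "T x = x + g x *\<^sub>R u" for x
  have T: "linear T"
    unfolding T_def using g by (auto intro!: linearI simp: linear_add linear_cmul algebra_simps)
  have Tu: "T u = - u"
    by (simp add: T_def g_def algebra_simps scaleR_2)
  let ?\<sigma> = "Transposition.transpose i j"
  have \<sigma>I: "?\<sigma> ` I = I"
    using ij by (auto simp: Transposition.transpose_def image_iff)
  have bij: "bij_betw ?\<sigma> I I"
    by (intro bij_betwI[of _ _ _ ?\<sigma>]) (use ij in \<open>auto simp: Transposition.transpose_def\<close>)
  define q where "q m = T (p (?\<sigma> m))" for m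
  define p' where "p' m = (1 - t) *\<^sub>R p m + t *\<^sub>R q m" for m
  have pu: "p (?\<sigma> m) - p m \<in> span {u}" for m
    using span_base[of u "{u}"] span_neg[OF span_base[of u "{u}"]]
    by (auto simp: Transposition.transpose_def u_def span_zero)
  have qp: "q m - p m \<in> span {u}" for m
  proof -
    have "q m - p m = (p (?\<sigma> m) - p m) + g (p (?\<sigma> m)) *\<^sub>R u"
      by (simp add: q_def T_def)
    also have "\<dots> \<in> span {u}"
      by (intro span_add pu span_scale span_base) simp
    finally show ?thesis .
  qed
  show ?thesis
  proof (intro exI[of _ p'] conjI allI impI)
    have "measure lebesgue (sym_hull q I) = measure lebesgue (sym_hull p I)"
    proof -
      have "measure lebesgue (convex hull (id ` T ` (p ` I \<union> uminus ` p ` I)))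
          = \<bar>1 + g u\<bar> * measure lebesgue (convex hull (id ` (p ` I \<union> uminus ` p ` I)))"
        unfolding image_image[of id T]
        by (rule measure_convex_hull_shear[where k=0]) (use I g in \<open>auto simp: T_def\<close>)
      moreover have "T ` (p ` I \<union> uminus ` p ` I) = q ` I \<union> uminus ` q ` I"
      proof -
        have "q ` I = T ` p ` I"
          using \<sigma>I by (force simp: q_def image_iff)
        moreover have "uminus ` T ` p ` I = T ` uminus ` p ` I"
          using linear_neg[OF T] by (force simp: image_iff)
        ultimately show ?thesis by (simp add: image_Un)
      qed
      moreover have "\<bar>1 + g u\<bar> = 1"
        by (simp add: g_def)
      ultimately show ?thesis
        by (simp add: sym_hull_def)
    qed
    moreover have "measure lebesgue (sym_hull p' I) \<le> (1 - t) * measure lebesgue (sym_hull p I) + t * measure lebesgue (sym_hull q I)"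
    proof -
      have eq: "(\<lambda>(m, s). s *\<^sub>R p' m) = (\<lambda>x. (1 - t) *\<^sub>R (\<lambda>(m, s). s *\<^sub>R p m) x + t *\<^sub>R (\<lambda>(m, s). s *\<^sub>R q m) x)"
        by (auto simp: p'_def fun_eq_iff algebra_simps)
      have "s *\<^sub>R q m - s *\<^sub>R p m \<in> span {u}" for s m
        using span_scale[OF qp[of m], of s] by (simp add: algebra_simps)
      then show ?thesis
        unfolding sym_hull_eq eq using I t
        by (intro shadow_system_measure_convex[where u=u]) auto
    qed
    ultimately show "measure lebesgue (sym_hull p' I) \<le> measure lebesgue (sym_hull p I)"
      by (simp add: algebra_simps)
  next
    fix l assume l: "relation p I l"
    have re: "(\<Sum>m\<in>I. f (?\<sigma> m)) = sum f I" for f :: "'i \<Rightarrow> 'a"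
      by (rule sum.reindex_bij_betw[OF bij])
    \<comment> \<open>Exchanging two coefficients changes the value of a relation by a multiple of
      \<open>u\<close>. As \<open>T u = - u\<close>, the two mixed terms \<open>T y\<close> and
      \<open>y\<close>, which carry equal weights, cancel.\<close>
    define y where "y = (\<Sum>m\<in>I. l (?\<sigma> m) *\<^sub>R p m)"
    have y1: "(\<Sum>m\<in>I. l m *\<^sub>R p (?\<sigma> m)) = y"
      using re[of "\<lambda>m. l (?\<sigma> m) *\<^sub>R p m"] by (simp add: y_def)
    have y: "y = (l j - l i) *\<^sub>R u"
    proof (cases "i = j")
      case True
      then show ?thesis using l by (simp add: y_def relation_def)
    next
      case False
      have "y = (\<Sum>m\<in>I. (l (?\<sigma> m) - l m) *\<^sub>R p m)"
        using l by (simp add: y_def relation_def scaleR_diff_left sum_subtractf)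
      also have "\<dots> = (\<Sum>m\<in>{i, j}. (l (?\<sigma> m) - l m) *\<^sub>R p m)"
        using I ij by (intro sum.mono_neutral_right) (auto simp: Transposition.transpose_def)
      also have "\<dots> = (l j - l i) *\<^sub>R u"
        using False by (simp add: u_def algebra_simps)
      finally show ?thesis .
    qed
    have "(\<Sum>m\<in>I. ((1 - t) * l m + t * l (?\<sigma> m)) *\<^sub>R p' m)
      = ((1 - t) * (1 - t)) *\<^sub>R (\<Sum>m\<in>I. l m *\<^sub>R p m) + ((1 - t) * t) *\<^sub>R (\<Sum>m\<in>I. l m *\<^sub>R q m)
       + (t * (1 - t)) *\<^sub>R (\<Sum>m\<in>I. l (?\<sigma> m) *\<^sub>R p m) + (t * t) *\<^sub>R (\<Sum>m\<in>I. l (?\<sigma> m) *\<^sub>R q m)"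
      unfolding p'_def scaleR_sum_right sum.distrib[symmetric]
      by (intro sum.cong refl) (simp only: scaleR_add_left scaleR_add_right scaleR_scaleR distrib_left distrib_right, simp only: mult_ac add_ac)
    also have "(\<Sum>m\<in>I. l m *\<^sub>R p m) = 0"
      using l by (simp add: relation_def)
    also have "(\<Sum>m\<in>I. l m *\<^sub>R q m) = T y"
      unfolding y1[symmetric] q_def linear_sum[OF T] linear_cmul[OF T] ..
    also have "(\<Sum>m\<in>I. l (?\<sigma> m) *\<^sub>R p m) = y"
      by (simp add: y_def)
    also have "(\<Sum>m\<in>I. l (?\<sigma> m) *\<^sub>R q m) = T 0"
      using l re[of "\<lambda>m. l m *\<^sub>R p m"] unfolding q_def linear_cmul[OF T, symmetric] linear_sum[OF T, symmetric]
      by (simp add: relation_def)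
    finally show "relation p' I (\<lambda>m. (1 - t) * l m + t * l (?\<sigma> m))"
      by (simp add: relation_def y linear_cmul[OF T] Tu linear_0[OF T] mult_ac)
  next
    fix J assume "J \<subseteq> I \<and> i \<in> J \<and> j \<in> J \<and> card J = Suc DIM('a)"
    then have J: "J \<subseteq> I" "i \<in> J" "j \<in> J" "card J = Suc DIM('a)" by auto
    have fJ: "finite J" using J I finite_subset by blast
    show "measure lebesgue (convex hull (p ` J)) \<le> measure lebesgue (convex hull (p' ` J))"
    proof (cases "measure lebesgue (convex hull (p ` J)) = 0")
      case False
      \<comment> \<open>The points \<open>p i\<close> and \<open>p j\<close> receive the same
        displacement. An affine function extending \<open>w\<close> from the vertices therefore has
        a linear part vanishing on \<open>u\<close>, and the shear has factor 1.\<close>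
      define w where "w m = t * ((q m - p m) \<bullet> u) / (u \<bullet> u)" for m
      have "T (p i) - T (p j) = p j - p i"
        using Tu by (simp add: u_def linear_diff[OF T])
      then have "q i - p i = q j - p j"
        by (simp add: q_def algebra_simps)
      then have wij: "w i = w j"
        by (simp add: w_def)
      have p'w: "p' m = p m + w m *\<^sub>R u" for m
      proof -
        obtain x where "q m - p m = x *\<^sub>R u"
          using qp[of m] by (auto simp: span_singleton)
        then have "p' m = p m + (t * x) *\<^sub>R u" "w m *\<^sub>R u = (t * x) *\<^sub>R u"
          by (auto simp: p'_def w_def algebra_simps)
        then show ?thesis by (simp only:)
      qed
      obtain h k where h: "linear h" "\<And>m. m \<in> J \<Longrightarrow> h (p m) + k = w m"
        using affine_functional_exists[OF nondegenerate_simplex[OF fJ J(4) False], of w] by blast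
      have "h u = 0"
        using h(2)[OF J(2)] h(2)[OF J(3)] wij linear_diff[OF h(1), of "p i" "p j"] by (simp add: u_def)
      moreover have "measure lebesgue (convex hull (p' ` J)) = \<bar>1 + h u\<bar> * measure lebesgue (convex hull (p ` J))"
        by (rule measure_convex_hull_shear[OF fJ h(1), where k=k]) (simp add: p'w h(2))
      ultimately show ?thesis by simp
    qed simp
  qed
qed

section \<open>Averaging over a block\<close>

definition block_average :: "'i set \<Rightarrow> ('i \<Rightarrow> real) \<Rightarrow> 'i \<Rightarrow> real" where
  "block_average A l m = (if m \<in> A then sum l A / card A else l m)"

lemma sum_block_average: "finite A \<Longrightarrow> sum (block_average A l) A = sum l A"
  by (cases "A = {}") (simp_all add: block_average_def)

lemma block_average_idem:
  assumes "finite A" shows "block_average A (block_average A l) = block_average A l"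
proof
  fix m show "block_average A (block_average A l) m = block_average A l m"
    using sum_block_average[OF assms, of l] unfolding block_average_def[of A "block_average A l"]
    by (simp add: block_average_def)
qed

text \<open>\<open>p'\<close> arises from \<open>p\<close> by averaging linear relations over the block \<open>A\<close>. The last clause lets a
  second relation be averaged without spoiling one that is already constant on \<open>A\<close>.\<close>

definition flattens :: "'i set \<Rightarrow> 'i set \<Rightarrow> ('i \<Rightarrow> 'a::euclidean_space) \<Rightarrow> ('i \<Rightarrow> 'a) \<Rightarrow> bool" where
  "flattens A I p p' \<longleftrightarrow>
    measure lebesgue (sym_hull p' I) \<le> measure lebesgue (sym_hull p I) \<and>
    (\<forall>J. A \<subseteq> J \<and> J \<subseteq> I \<and> card J = Suc DIM('a) \<longrightarrow>
        measure lebesgue (convex hull (p ` J)) \<le> measure lebesgue (convex hull (p' ` J))) \<and>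
    (\<forall>l. relation p I l \<longrightarrow> (\<exists>l'. relation p' I l' \<and> block_average A l' = block_average A l \<and>
       (block_average A l = l \<longrightarrow> l' = l)))"

lemma flattens_refl: "flattens A I p p"
  unfolding flattens_def by auto

lemma flattens_relation:
  assumes "flattens A I p p'" "relation p I l"
  shows "\<exists>l'. relation p' I l' \<and> block_average A l' = block_average A l \<and> (block_average A l = l \<longrightarrow> l' = l)"
  using assms unfolding flattens_def by simp

lemma flattens_trans:
  assumes 1: "flattens A I p p'" and 2: "flattens A I p' p''"
  shows "flattens A I p p''"
  unfolding flattens_def
proof (intro conjI allI impI)
  show "measure lebesgue (sym_hull p'' I) \<le> measure lebesgue (sym_hull p I)"
    using 1 2 unfolding flattens_def by linarith
next
  fix J assume "A \<subseteq> J \<and> J \<subseteq> I \<and> card J = Suc DIM('b)"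
  then show "measure lebesgue (convex hull (p ` J)) \<le> measure lebesgue (convex hull (p'' ` J))"
    using 1 2 unfolding flattens_def by (meson order_trans)
next
  fix l assume "relation p I l"
  then obtain l' where l': "relation p' I l'" "block_average A l' = block_average A l" "block_average A l = l \<longrightarrow> l' = l"
    using flattens_relation[OF 1] by blast
  then obtain l'' where "relation p'' I l''" "block_average A l'' = block_average A l'" "block_average A l' = l' \<longrightarrow> l'' = l'"
    using flattens_relation[OF 2] by blast
  with l' show "\<exists>l''. relation p'' I l'' \<and> block_average A l'' = block_average A l \<and>
       (block_average A l = l \<longrightarrow> l'' = l)"
    by (intro exI[of _ l'']) simp
qed

text \<open>Induction on the number of coefficients in \<open>A\<close> that differ from their mean.
  A step acts on one coefficient above and one below the mean and stops when the first reaches it;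
  no other coefficient changes, so the count drops and no limit process arises.\<close>

lemma average_one_relation:
  fixes p :: "'i \<Rightarrow> 'a::euclidean_space"
  assumes I: "finite I" and A: "A \<subseteq> I" and l0: "relation p I l0"
  shows "\<exists>p'. flattens A I p p' \<and> relation p' I (block_average A l0)"
  using l0
proof (induction "card {m\<in>A. l0 m \<noteq> block_average A l0 m}" arbitrary: p l0 rule: less_induct)
  case less
  have fA: "finite A" using A I finite_subset by blast
  define a where "a = sum l0 A / card A"
  have avg: "block_average A l0 m = a" if "m \<in> A" for m
    using that by (simp add: block_average_def a_def)
  show ?case
  proof (cases "\<forall>m\<in>A. l0 m = a")
    case True
    then have "block_average A l0 = l0"
      using avg by (auto simp: block_average_def fun_eq_iff)
    then show ?thesis
      using less.prems flattens_refl by metis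
  next
    case False
    then have "A \<noteq> {}" by auto
    then have sum0: "(\<Sum>m\<in>A. l0 m - a) = 0"
      using fA by (simp add: sum_subtractf a_def)
    obtain i where i: "i \<in> A" "l0 i > a"
    proof (rule ccontr)
      assume "\<not> thesis"
      then have "\<forall>m\<in>A. a - l0 m \<ge> 0" using that by force
      moreover have "(\<Sum>m\<in>A. a - l0 m) = 0" using sum0 by (simp add: sum_subtractf)
      ultimately have "\<forall>m\<in>A. a - l0 m = 0" using fA by (simp add: sum_nonneg_eq_0_iff)
      with False show False by auto
    qed
    obtain j where j: "j \<in> A" "l0 j < a"
    proof (rule ccontr)
      assume "\<not> thesis"
      then have "\<forall>m\<in>A. l0 m - a \<ge> 0" using that by force
      then have "\<forall>m\<in>A. l0 m - a = 0" using fA sum0 by (simp add: sum_nonneg_eq_0_iff)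
      with False show False by auto
    qed
    \<comment> \<open>The solution of \<open>(1 - t) * l0 i + t * l0 j = a\<close>; it lies between
      0 and 1 because \<open>a\<close> separates the two values.\<close>
    define t where "t = (l0 i - a) / (l0 i - l0 j)"
    have t: "0 \<le> t" "t \<le> 1" using i j by (auto simp: t_def field_simps)
    let ?mv = "\<lambda>l m. (1 - t) * l m + t * l (Transposition.transpose i j m)"
    have "i \<in> I" "j \<in> I" using i j A by auto
    from pair_averaging[OF I this t, of p]
    obtain p1 :: "'i \<Rightarrow> 'a" where p1: "measure lebesgue (sym_hull p1 I) \<le> measure lebesgue (sym_hull p I)"
      "\<forall>l. relation p I l \<longrightarrow> relation p1 I (?mv l)"
      "\<forall>J. J \<subseteq> I \<and> i \<in> J \<and> j \<in> J \<and> card J = Suc DIM('a) \<longrightarrow>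
        measure lebesgue (convex hull (p ` J)) \<le> measure lebesgue (convex hull (p1 ` J))"
      by (elim exE conjE) (rule that)
    have bij: "bij_betw (Transposition.transpose i j) A A"
      by (intro bij_betwI[of _ _ _ "Transposition.transpose i j"]) (use i j in \<open>auto simp: Transposition.transpose_def\<close>)
    have mv_sum: "sum (?mv l) A = sum l A" for l
      using sum.reindex_bij_betw[OF bij, of l]
      by (simp add: sum.distrib sum_distrib_left[symmetric]) (simp add: algebra_simps)
    have mv_avg: "block_average A (?mv l) = block_average A l" for l
    proof
      fix m
      have "m \<notin> A \<Longrightarrow> Transposition.transpose i j m = m"
        using i j by (auto simp: Transposition.transpose_def)
      then show "block_average A (?mv l) m = block_average A l m"
        unfolding block_average_def mv_sum by (simp add: algebra_simps)
    qed
    have mv_fix: "?mv l = l" if l: "block_average A l = l" for l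
    proof
      fix m
      have "l (Transposition.transpose i j m) = l m"
        using i j by (subst (1 2) l[symmetric]) (auto simp: block_average_def Transposition.transpose_def)
      then show "?mv l m = l m" by (simp add: algebra_simps)
    qed
    have tt: "t * (l0 i - l0 j) = l0 i - a"
      using i j by (simp add: t_def)
    have mvi: "?mv l0 i = a"
      using tt by (simp add: algebra_simps)
    have "{m\<in>A. ?mv l0 m \<noteq> block_average A (?mv l0) m} \<subset> {m\<in>A. l0 m \<noteq> block_average A l0 m}"
    proof -
      have "?mv l0 m = l0 m" if "m \<noteq> i" "m \<noteq> j" for m
        using that by (simp add: Transposition.transpose_def algebra_simps)
      then show ?thesis
        unfolding mv_avg using i j mvi avg by (intro psubsetI subsetI) (smt (verit) mem_Collect_eq)+
    qed
    then have "card {m\<in>A. ?mv l0 m \<noteq> block_average A (?mv l0) m} < card {m\<in>A. l0 m \<noteq> block_average A l0 m}"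
      using fA by (intro psubset_card_mono) auto
    from less.hyps[OF this p1(2)[rule_format, OF less.prems]]
    obtain p' where p': "flattens A I p1 p'" "relation p' I (block_average A (?mv l0))"
      by blast
    have "flattens A I p p1"
      unfolding flattens_def
    proof (intro conjI allI impI)
      fix l assume "relation p I l"
      then show "\<exists>l'. relation p1 I l' \<and> block_average A l' = block_average A l \<and> (block_average A l = l \<longrightarrow> l' = l)"
        using p1(2) mv_avg mv_fix by (intro exI[of _ "?mv l"]) simp
    qed (use p1 i j in auto)
    with p' mv_avg[of l0] show ?thesis
      using flattens_trans by fastforce
  qed
qed

text \<open>Averaging \<open>\<beta>\<close> turns \<open>\<gamma>\<close> into some
  \<open>\<gamma>'\<close> with the same block average, which is averaged next. The averaged
  \<open>\<beta>\<close> is a fixed point of block averaging, so it survives the second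
  round.\<close>

lemma average_two_relations:
  fixes p :: "'i \<Rightarrow> 'a::euclidean_space"
  assumes I: "finite I" and A: "A \<subseteq> I" and \<beta>: "relation p I \<beta>" and \<gamma>: "relation p I \<gamma>"
  shows "\<exists>p'. flattens A I p p' \<and> relation p' I (block_average A \<beta>) \<and> relation p' I (block_average A \<gamma>)"
proof -
  have fA: "finite A" using A I finite_subset by blast
  obtain p1 where p1: "flattens A I p p1" "relation p1 I (block_average A \<beta>)"
    using average_one_relation[OF I A \<beta>] by blast
  obtain \<gamma>' where \<gamma>': "relation p1 I \<gamma>'" "block_average A \<gamma>' = block_average A \<gamma>"
    using flattens_relation[OF p1(1) \<gamma>] by blast
  obtain p2 where p2: "flattens A I p1 p2" "relation p2 I (block_average A \<gamma>')"
    using average_one_relation[OF I A \<gamma>'(1)] by blast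
  obtain l' where "relation p2 I l'" "l' = block_average A \<beta>"
    using flattens_relation[OF p2(1) p1(2)] block_average_idem[OF fA, of \<beta>] by auto
  with p2 \<gamma>'(2) flattens_trans[OF p1(1) p2(1)] show ?thesis
    by auto
qed

text \<open>Cramer's rule without signs. Up to sign, \<open>\<beta> a / \<beta> b\<close> is the
  barycentric coordinate of \<open>p b\<close> at the vertex \<open>p a\<close>, and replacing
  \<open>p a\<close> by \<open>p b\<close> is a shear with that factor. Proving one inequality and
  exchanging \<open>a\<close> and \<open>b\<close> absorbs the degenerate cases.\<close>

lemma simplex_measure_ratio:
  fixes p :: "'i \<Rightarrow> 'a::euclidean_space"
  assumes I: "finite I" "card I = DIM('a) + 2" and ab: "a \<in> I" "b \<in> I"
    and rel: "relation p I \<beta>" and sum0: "sum \<beta> I = 0"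
  shows "\<bar>\<beta> a\<bar> * measure lebesgue (convex hull (p ` (I - {b}))) =
     \<bar>\<beta> b\<bar> * measure lebesgue (convex hull (p ` (I - {a})))"
proof -
  have le: "\<bar>\<beta> a\<bar> * measure lebesgue (convex hull (p ` (I - {b}))) \<le>
     \<bar>\<beta> b\<bar> * measure lebesgue (convex hull (p ` (I - {a})))" if ab: "a \<in> I" "b \<in> I" for a b
  proof (cases "a = b \<or> measure lebesgue (convex hull (p ` (I - {b}))) = 0")
    case False
    let ?J = "I - {b}"
    have J: "finite ?J" "card ?J = Suc DIM('a)" using I ab by auto
    have ne: "measure lebesgue (convex hull (p ` ?J)) \<noteq> 0" using False by simp
    \<comment> \<open>Prescribing 1 at \<open>a\<close> and 0 at the other vertices makes the affine
      functional the barycentric coordinate at \<open>p a\<close>.\<close>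
    define w :: "'i \<Rightarrow> real" where "w m = (if m = a then 1 else 0)" for m
    obtain g k where g: "linear g" "\<And>m. m \<in> ?J \<Longrightarrow> g (p m) + k = w m"
      using affine_functional_exists[OF nondegenerate_simplex[OF J ne], of w] by blast
    have "(\<Sum>m\<in>I. \<beta> m * (g (p m) + k)) = g (\<Sum>m\<in>I. \<beta> m *\<^sub>R p m) + sum \<beta> I * k"
      by (simp add: linear_sum[OF g(1)] linear_cmul[OF g(1)] distrib_left sum.distrib sum_distrib_right)
    also have "\<dots> = 0"
      using rel sum0 linear_0[OF g(1)] by (simp add: relation_def)
    finally have "0 = \<beta> b * (g (p b) + k) + (\<Sum>m\<in>?J. \<beta> m * (g (p m) + k))"
      using sum.remove[OF I(1) ab(2), of "\<lambda>m. \<beta> m * (g (p m) + k)"] by simp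
    also have "(\<Sum>m\<in>?J. \<beta> m * (g (p m) + k)) = (\<Sum>m\<in>?J. if m = a then \<beta> m else 0)"
      by (rule sum.cong) (auto simp: g(2) w_def)
    also have "\<dots> = \<beta> a"
      using I ab False by simp
    finally have b: "\<beta> a = - \<beta> b * (g (p b) + k)"
      by simp
    define q where "q m = (if m = a then p b else p m)" for m
    have "q ` ?J = p ` (I - {a})"
      using ab False by (auto simp: q_def image_iff)
    moreover have "measure lebesgue (convex hull (q ` ?J)) =
        \<bar>1 + g (p b - p a)\<bar> * measure lebesgue (convex hull (p ` ?J))"
      by (rule measure_convex_hull_shear[OF J(1) g(1), where k=k]) (auto simp: q_def g(2) w_def)
    moreover have "1 + g (p b - p a) = g (p b) + k"
      using g(2)[of a] ab False by (simp add: linear_diff[OF g(1)] w_def)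
    ultimately show ?thesis
      by (simp add: b abs_mult)
  qed auto
  show ?thesis
    using le[OF ab] le[OF ab(2) ab(1)] by linarith
qed

section \<open>Dissection of balanced configurations\<close>

lemma insert_zero_image_eq: "insert 0 (q ` J) = case_option 0 q ` insert None (Some ` J)"
  by (auto simp: image_iff)

lemma mem_convex_hull_insert_zero:
  fixes q :: "'i \<Rightarrow> 'a::real_vector"
  assumes "finite J" "\<And>m. m \<in> J \<Longrightarrow> 0 \<le> c m" "sum c J \<le> 1"
  shows "(\<Sum>m\<in>J. c m *\<^sub>R q m) \<in> convex hull (insert 0 (q ` J))"
  unfolding insert_zero_image_eq
  using assms by (subst convex_hull_image_eq)
    (auto simp: sum.reindex intro!: exI[of _ "case_option (1 - sum c J) c"])

lemma compact_convex_hull_insert_zero: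
  fixes q :: "'i \<Rightarrow> 'a::euclidean_space"
  shows "finite J \<Longrightarrow> compact (convex hull (insert 0 (q ` J)))"
  by (simp add: finite_imp_compact_convex_hull)

context
  fixes q :: "'i \<Rightarrow> 'a::euclidean_space" and J
  assumes J: "finite J" "card J = DIM('a)" and ne: "measure lebesgue (convex hull (insert 0 (q ` J))) \<noteq> 0"
begin

lemma origin_simplex_independent:
  "inj_on (case_option 0 q) (insert None (Some ` J))" "\<not> affine_dependent (insert 0 (q ` J))"
proof -
  have J': "finite (insert None (Some ` J))" "card (insert None (Some ` J)) = Suc DIM('a)"
    using J by (auto simp: card_image)
  show "inj_on (case_option 0 q) (insert None (Some ` J))" "\<not> affine_dependent (insert 0 (q ` J))"
    using nondegenerate_simplex[OF J', of "case_option 0 q"] ne unfolding insert_zero_image_eq by auto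
qed

lemma origin_simplex_functional:
  "\<exists>g. linear g \<and> (\<forall>m\<in>J. g (q m) = (w m :: real))"
proof -
  obtain g k where g: "linear g" "\<forall>m\<in>insert None (Some ` J). g (case_option 0 q m) + k = case_option 0 w m"
    using affine_functional_exists[OF origin_simplex_independent(1), of "case_option 0 w"]
      origin_simplex_independent(2) unfolding insert_zero_image_eq by auto
  from g have "k = 0" by (simp add: linear_0)
  with g show ?thesis by auto
qed

lemma origin_simplex_linear_independent:
  assumes "(\<Sum>m\<in>J. c m *\<^sub>R q m) = 0" "a \<in> J"
  shows "c a = 0"
proof -
  obtain g where g: "linear g" "\<forall>m\<in>J. g (q m) = (if m = a then 1 else 0 :: real)"
    using origin_simplex_functional[of "\<lambda>m. if m = a then 1 else 0"] by metis
  have "0 = g (\<Sum>m\<in>J. c m *\<^sub>R q m)"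
    using assms(1) g(1) by (simp add: linear_0)
  also have "\<dots> = (\<Sum>m\<in>J. if m = a then c m else 0)"
    unfolding linear_sum[OF g(1)] linear_cmul[OF g(1)] by (intro sum.cong) (auto simp: g(2))
  finally show ?thesis
    using J assms(2) by simp
qed

text \<open>Strict positivity is the point: it fixes the signs of the coefficients of interior
  points, by which different cells are told apart.\<close>

lemma origin_simplex_interior:
  assumes "x \<in> interior (convex hull (insert 0 (q ` J)))"
  shows "\<exists>c. x = (\<Sum>m\<in>J. c m *\<^sub>R q m) \<and> (\<forall>m\<in>J. 0 < c m)"
proof -
  have inj: "inj_on q J" "0 \<notin> q ` J"
    using origin_simplex_independent(1) by (auto simp: inj_on_def)
  obtain u where u: "\<forall>x\<in>insert 0 (q ` J). 0 < u x" "(\<Sum>x\<in>insert 0 (q ` J). u x *\<^sub>R x) = x"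
    using assms interior_convex_hull_explicit_minimal[OF origin_simplex_independent(2)]
    by (auto split: if_splits)
  have "(\<Sum>x\<in>insert 0 (q ` J). u x *\<^sub>R x) = (\<Sum>m\<in>J. u (q m) *\<^sub>R q m)"
    using J inj by (simp add: sum.reindex)
  with u show ?thesis
    by (intro exI[of _ "\<lambda>m. u (q m)"]) auto
qed

end

definition flip :: "'i set \<Rightarrow> ('i \<Rightarrow> 'a::real_vector) \<Rightarrow> 'i \<Rightarrow> 'a" where
  "flip H p m = (if m \<in> H then - p m else p m)"

text \<open>Negating one vertex is a shear along that vertex with factor \<open>-1\<close>. Since
  negating twice restores the family, one inequality suffices, and a degenerate simplex satisfies it
  trivially.\<close>

lemma measure_flip:
  fixes p :: "'i \<Rightarrow> 'a::euclidean_space"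
  assumes J: "finite J" "card J = DIM('a)" and H: "finite H"
  shows "measure lebesgue (convex hull (insert 0 (flip H p ` J))) = measure lebesgue (convex hull (insert 0 (p ` J)))"
proof -
  have le: "measure lebesgue (convex hull (insert 0 (q ` J))) \<le> measure lebesgue (convex hull (insert 0 (q(a := - q a) ` J)))"
    for q :: "'i \<Rightarrow> 'a" and a
  proof (cases "a \<in> J \<and> measure lebesgue (convex hull (insert 0 (q ` J))) \<noteq> 0")
    case True
    define w :: "'i \<Rightarrow> real" where "w m = (if m = a then 1 else 0)" for m
    obtain g where g: "linear g" "\<forall>m\<in>J. g (q m) = w m"
      using origin_simplex_functional[OF J, of q w] True by blast
    have "measure lebesgue (convex hull (case_option 0 (q(a := - q a)) ` insert None (Some ` J))) =
      \<bar>1 + g (- 2 *\<^sub>R q a)\<bar> * measure lebesgue (convex hull (case_option 0 q ` insert None (Some ` J)))"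
      by (rule measure_convex_hull_shear[OF _ g(1), where k=0])
        (use J True g in \<open>auto simp: w_def linear_0 scaleR_2\<close>)
    moreover have "g (- 2 *\<^sub>R q a) = - 2"
      using g True linear_cmul[OF g(1), of "- 2" "q a"] by (simp add: w_def)
    ultimately show ?thesis
      unfolding insert_zero_image_eq by (simp del: image_insert)
  next
    case False
    have "a \<notin> J \<Longrightarrow> q(a := - q a) ` J = q ` J"
      by (auto simp: image_iff)
    with False show ?thesis
      by auto
  qed
  have eq: "measure lebesgue (convex hull (insert 0 (q(a := - q a) ` J))) = measure lebesgue (convex hull (insert 0 (q ` J)))"
    for q :: "'i \<Rightarrow> 'a" and a
    using le[of q a] le[of "q(a := - q a)" a] by simp
  show ?thesis
    using H
  proof (induction H)
    case empty
    then show ?case by (simp add: flip_def[abs_def])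
  next
    case (insert a H)
    have "flip (insert a H) p = (flip H p)(a := - flip H p a)"
      using insert.hyps by (auto simp: flip_def fun_eq_iff)
    then show ?case
      using eq[of "flip H p" a] insert.IH by simp
  qed
qed

text \<open>A pattern \<open>(a, F)\<close> prescribes signs of coefficients on the block \<open>A\<close>: zero at \<open>a\<close>, negative on
  \<open>F\<close>, positive elsewhere.\<close>

definition sign_patterns :: "'i set \<Rightarrow> nat \<Rightarrow> ('i \<times> 'i set) set" where
  "sign_patterns A i = (SIGMA a:A. {F. F \<subseteq> A - {a} \<and> card F = i})"

lemma mem_sign_patterns: "(a, F) \<in> sign_patterns A i \<longleftrightarrow> a \<in> A \<and> F \<subseteq> A - {a} \<and> card F = i"
  by (simp add: sign_patterns_def)

lemma finite_sign_patterns: "finite A \<Longrightarrow> finite (sign_patterns A i)"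
  by (auto simp: sign_patterns_def intro!: finite_SigmaI)

text \<open>The source of the binomial coefficients: the volume of a cell depends only on the
  positions of the zeros, and each zero \<open>a\<close> belongs to \<open>k choose i\<close>
  patterns.\<close>

lemma sum_sign_patterns:
  fixes f :: "'i \<Rightarrow> real"
  assumes "finite A" "card A = Suc k"
  shows "(\<Sum>x\<in>sign_patterns A i. f (fst x)) = real (k choose i) * sum f A"
proof -
  have "(\<Sum>x\<in>sign_patterns A i. f (fst x)) = (\<Sum>a\<in>A. \<Sum>F\<in>{F. F \<subseteq> A - {a} \<and> card F = i}. f a)"
    unfolding sign_patterns_def using assms by (subst sum.Sigma) (auto simp: case_prod_unfold)
  also have "\<dots> = (\<Sum>a\<in>A. real (k choose i) * f a)"
  proof (rule sum.cong)
    fix a assume "a \<in> A"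
    then have "card {F. F \<subseteq> A - {a} \<and> card F = i} = k choose i"
      using assms n_subsets[of "A - {a}" i] by simp
    then show "(\<Sum>F\<in>{F. F \<subseteq> A - {a} \<and> card F = i}. f a) = real (k choose i) * f a"
      by simp
  qed simp
  finally show ?thesis
    by (simp add: sum_distrib_left)
qed

text \<open>As \<open>p\<close> sums to zero over each block, coefficients matter only up to a constant on each block. Patterns
  with a fixed number of negative signs pick one representative of each generic class.\<close>

lemma sign_patterns_shift_unique:
  fixes c c' :: "'i \<Rightarrow> real"
  assumes A: "finite A" and pats: "(a, F) \<in> sign_patterns A i" "(a', F') \<in> sign_patterns A i"
    and c: "c a = 0" "\<And>m. m \<in> F \<Longrightarrow> c m < 0" "\<And>m. m \<in> A - {a} - F \<Longrightarrow> 0 < c m"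
    and c': "c' a' = 0" "\<And>m. m \<in> F' \<Longrightarrow> c' m < 0" "\<And>m. m \<in> A - {a'} - F' \<Longrightarrow> 0 < c' m"
    and shift: "\<And>m. m \<in> A \<Longrightarrow> c' m = c m + t"
  shows "a' = a \<and> F' = F"
proof -
  have F: "F = {m\<in>A. c m < 0}" "F' = {m\<in>A. c' m < 0}"
    using pats c c' by (auto simp: mem_sign_patterns dest: order.strict_trans) (metis DiffI empty_iff insertE not_less_iff_gr_or_eq)+
  have a: "{m\<in>A. c m = 0} = {a}" "{m\<in>A. c' m = 0} = {a'}"
    using pats c c' by (auto simp: mem_sign_patterns) (metis DiffI empty_iff insertE less_irrefl)+
  have le: "insert a F = {m\<in>A. c m \<le> 0}" "insert a' F' = {m\<in>A. c' m \<le> 0}"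
    using F a by force+
  have card: "card F = i" "card F' = i" "card (insert a F) = Suc i" "card (insert a' F') = Suc i"
    using pats A by (auto simp: mem_sign_patterns card_insert_if finite_subset)
  \<comment> \<open>For \<open>t > 0\<close>, the \<open>i + 1\<close> entries with
    \<open>c' m \<le> 0\<close> would all have \<open>c m < 0\<close>, but only \<open>i\<close>
    entries do. The case \<open>t < 0\<close> is symmetric.\<close>
  have "t = 0"
  proof (rule ccontr)
    assume "t \<noteq> 0"
    then consider "t > 0" | "t < 0" by linarith
    then show False
    proof cases
      case 1
      then have "insert a' F' \<subseteq> F"
        unfolding le F(1) using shift by fastforce
      then have "Suc i \<le> i"
        using card card_mono[of F "insert a' F'"] A F(1) by simp
      then show False by simp
    next
      case 2
      then have "insert a F \<subseteq> F'"
        unfolding le F(2) using shift by fastforce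
      then have "Suc i \<le> i"
        using card card_mono[of F' "insert a F"] A F(2) by simp
      then show False by simp
    qed
  qed
  with shift have "{m\<in>A. c' m < 0} = {m\<in>A. c m < 0}" "{m\<in>A. c' m = 0} = {m\<in>A. c m = 0}"
    by auto
  with F a show ?thesis by auto
qed

text \<open>Order statistics with ties broken arbitrarily: \<open>F\<close> collects
  \<open>i\<close> smallest entries and \<open>a\<close> is the next one. The induction splits off a
  minimum.\<close>

lemma sign_patterns_rank_exists:
  fixes c :: "'i \<Rightarrow> real"
  assumes "finite A" "i < card A"
  shows "\<exists>a F. (a, F) \<in> sign_patterns A i \<and> (\<forall>m\<in>F. c m \<le> c a) \<and> (\<forall>m\<in>A - {a} - F. c a \<le> c m)"
  using assms
proof (induction i arbitrary: A)
  case 0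
  then obtain a where "a \<in> A" "\<And>m. m \<in> A \<Longrightarrow> c a \<le> c m"
    using ex_min_if_finite[of "c ` A"] by (force simp: not_less)
  then show ?case
    by (intro exI[of _ a] exI[of _ "{}"]) (auto simp: mem_sign_patterns)
next
  case (Suc i)
  then have "A \<noteq> {}" by auto
  then obtain b where b: "b \<in> A" "\<And>m. m \<in> A \<Longrightarrow> c b \<le> c m"
    using ex_min_if_finite[of "c ` A"] Suc.prems by (force simp: not_less)
  obtain a F where aF: "(a, F) \<in> sign_patterns (A - {b}) i" "\<forall>m\<in>F. c m \<le> c a" "\<forall>m\<in>A - {b} - {a} - F. c a \<le> c m"
    using Suc.IH[of "A - {b}"] Suc.prems b(1) by (auto simp: less_diff_conv)
  moreover have "finite F"
    using aF(1) Suc.prems by (auto simp: mem_sign_patterns intro: finite_subset)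
  ultimately show ?case
    using b by (intro exI[of _ a] exI[of _ "insert b F"]) (auto simp: mem_sign_patterns card_insert_if)
qed

text \<open>A median minimises the sum of absolute deviations; here it is compared with deviation
  from 0. The entry at \<open>a\<close> drops to 0, and this saving makes up for the imbalance of
  one between \<open>F\<close> and the remaining entries when \<open>k\<close> is odd.\<close>

lemma median_shift:
  fixes c :: "'i \<Rightarrow> real"
  assumes A: "finite A" "card A = Suc k" and aF: "(a, F) \<in> sign_patterns A (k div 2)"
    and c: "\<And>m. m \<in> F \<Longrightarrow> c m \<le> c a" "\<And>m. m \<in> A - {a} - F \<Longrightarrow> c a \<le> c m"
  shows "(\<Sum>m\<in>A. \<bar>c m - c a\<bar>) \<le> (\<Sum>m\<in>A. \<bar>c m\<bar>)"
proof -
  let ?i = "k div 2" and ?P = "A - {a} - F"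
  have F: "F \<subseteq> A - {a}" "card F = ?i" "a \<in> A" "finite F"
    using aF A by (auto simp: mem_sign_patterns intro: finite_subset)
  have cP: "card ?P = k - ?i"
    using A F by (simp add: card_Diff_subset)
  have split: "sum f A = f a + sum f F + sum f ?P" for f :: "'i \<Rightarrow> real"
  proof -
    have "sum f A = f a + sum f (A - {a})"
      using A F by (simp add: sum.remove)
    also have "sum f (A - {a}) = sum f ?P + sum f F"
      using A F by (simp add: sum.subset_diff)
    finally show ?thesis by simp
  qed
  show ?thesis
  proof (cases "c a \<ge> 0")
    case True
    have "(\<Sum>m\<in>F. \<bar>c m - c a\<bar>) \<le> (\<Sum>m\<in>F. \<bar>c m\<bar> + c a)"
      using True by (intro sum_mono) auto
    moreover have "(\<Sum>m\<in>?P. \<bar>c m - c a\<bar>) \<le> (\<Sum>m\<in>?P. \<bar>c m\<bar> - c a)"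
      using True c(2) by (intro sum_mono) force
    moreover have "real ?i * c a \<le> (real (k - ?i) + 1) * c a"
      using True by (intro mult_right_mono) (auto simp: of_nat_diff)
    ultimately show ?thesis
      using F cP True by (simp add: split sum.distrib sum_subtractf algebra_simps)
  next
    case False
    have "(\<Sum>m\<in>F. \<bar>c m - c a\<bar>) \<le> (\<Sum>m\<in>F. \<bar>c m\<bar> + c a)"
      using False c(1) by (intro sum_mono) force
    moreover have "(\<Sum>m\<in>?P. \<bar>c m - c a\<bar>) \<le> (\<Sum>m\<in>?P. \<bar>c m\<bar> - c a)"
      using False by (intro sum_mono) auto
    moreover have "real (k - ?i) \<le> real ?i + 1"
      by linarith
    then have "(real ?i + 1) * c a \<le> real (k - ?i) * c a"
      using False by (intro mult_right_mono_neg) auto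
    ultimately show ?thesis
      using F cP False by (simp add: split sum.distrib sum_subtractf algebra_simps)
  qed
qed

section \<open>Cells of a balanced configuration\<close>

locale balanced_blocks =
  fixes p :: "'i \<Rightarrow> 'a::euclidean_space" and A B :: "'i set" and k l :: nat
  assumes finite_blocks: "finite A" "finite B" and disjoint: "A \<inter> B = {}"
    and card_blocks: "card A = Suc k" "card B = Suc l" and dim: "k + l = DIM('a)"
    and balanced: "(\<Sum>m\<in>A. p m) = 0" "(\<Sum>m\<in>B. p m) = 0"
begin

definition W :: "'i \<Rightarrow> 'i \<Rightarrow> real" where
  "W a b = measure lebesgue (convex hull (insert 0 (p ` (A \<union> B - {a, b}))))"

lemma card_minus2: "a \<in> A \<Longrightarrow> b \<in> B \<Longrightarrow> card (A \<union> B - {a, b}) = DIM('a)"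
proof -
  assume ab: "a \<in> A" "b \<in> B"
  then have "a \<noteq> b" using disjoint by auto
  moreover have "card (A \<union> B) = Suc (Suc DIM('a))"
    using finite_blocks disjoint card_blocks dim by (simp add: card_Un_disjoint)
  ultimately show ?thesis
    using ab finite_blocks by (subst card_Diff_subset) auto
qed

lemma shift_sum:
  "(\<Sum>m\<in>A \<union> B. (c m - (if m \<in> A then s else t)) *\<^sub>R p m) = (\<Sum>m\<in>A \<union> B. c m *\<^sub>R p m)"
proof -
  have "(\<Sum>m\<in>A \<union> B. (if m \<in> A then s else t) *\<^sub>R p m)
    = (\<Sum>m\<in>A. (if m \<in> A then s else t) *\<^sub>R p m) + (\<Sum>m\<in>B. (if m \<in> A then s else t) *\<^sub>R p m)"
    using finite_blocks disjoint by (rule sum.union_disjoint)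
  also have "(\<Sum>m\<in>A. (if m \<in> A then s else t) *\<^sub>R p m) = s *\<^sub>R (\<Sum>m\<in>A. p m)"
    by (simp add: scaleR_sum_right)
  also have "(\<Sum>m\<in>B. (if m \<in> A then s else t) *\<^sub>R p m) = t *\<^sub>R (\<Sum>m\<in>B. p m)"
    unfolding scaleR_sum_right using disjoint by (intro sum.cong) auto
  finally show ?thesis
    by (simp add: balanced scaleR_diff_left sum_subtractf)
qed

lemma sum_minus2:
  fixes f :: "'i \<Rightarrow> 'b::comm_monoid_add"
  assumes "f a = 0" "f b = 0"
  shows "sum f (A \<union> B - {a, b}) = sum f (A \<union> B)"
  using finite_blocks assms by (intro sum.mono_neutral_left) auto

text \<open>If \<open>W a b \<noteq> 0\<close>, the points other than \<open>p a\<close> and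
  \<open>p b\<close> form a basis, so the relations are exactly those spanned by the two vanishing
  block sums. Subtracting the values at \<open>a\<close> and \<open>b\<close> leaves a relation on
  that basis.\<close>

lemma relation_constant_on_blocks:
  assumes ab: "a \<in> A" "b \<in> B" and W: "W a b \<noteq> 0" and d: "(\<Sum>m\<in>A \<union> B. d m *\<^sub>R p m) = 0"
    and m: "m \<in> A \<union> B"
  shows "d m = (if m \<in> A then d a else d b)"
proof (cases "m = a \<or> m = b")
  case True
  then show ?thesis using ab disjoint by auto
next
  case False
  define e where "e m = d m - (if m \<in> A then d a else d b)" for m
  have e0: "e a = 0" "e b = 0"
    using ab disjoint by (auto simp: e_def)
  have "(\<Sum>m\<in>A \<union> B - {a, b}. e m *\<^sub>R p m) = (\<Sum>m\<in>A \<union> B. e m *\<^sub>R p m)"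
    by (rule sum_minus2) (simp_all add: e0)
  also have "\<dots> = 0"
    using d by (simp add: e_def shift_sum)
  finally have "e m = 0"
    using origin_simplex_linear_independent[of "A \<union> B - {a, b}" p e m] W card_minus2[OF ab] finite_blocks m False
    by (simp add: W_def)
  then show ?thesis by (simp add: e_def)
qed

text \<open>The combinations whose coefficients have the signs prescribed by both patterns and
  absolute sum at most 1.\<close>

definition cell :: "('i \<times> 'i set) \<times> ('i \<times> 'i set) \<Rightarrow> 'a set" where
  "cell = (\<lambda>((a, F), (b, G)). convex hull (insert 0 (flip (F \<union> G) p ` (A \<union> B - {a, b}))))"

lemma measure_cell:
  assumes "(a, F) \<in> sign_patterns A i" "(b, G) \<in> sign_patterns B j"
  shows "measure lebesgue (cell ((a, F), (b, G))) = W a b"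
proof -
  have "finite (F \<union> G)"
    using assms finite_blocks by (auto simp: mem_sign_patterns intro: finite_subset)
  then show ?thesis
    using assms finite_blocks card_minus2[of a b] by (simp add: cell_def W_def measure_flip mem_sign_patterns)
qed

lemma compact_cell: "compact (cell x)"
  using finite_blocks by (auto simp: cell_def finite_imp_compact_convex_hull split: prod.split)

lemma sum_cells:
  "(\<Sum>x\<in>sign_patterns A i \<times> sign_patterns B j. measure lebesgue (cell x)) =
    real (k choose i) * real (l choose j) * (\<Sum>a\<in>A. \<Sum>b\<in>B. W a b)"
proof -
  have "(\<Sum>x\<in>sign_patterns A i \<times> sign_patterns B j. measure lebesgue (cell x)) =
      (\<Sum>x\<in>sign_patterns A i. \<Sum>y\<in>sign_patterns B j. W (fst x) (fst y))"
    unfolding sum.cartesian_product by (intro sum.cong) (auto simp: measure_cell)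
  also have "\<dots> = (\<Sum>x\<in>sign_patterns A i. real (l choose j) * (\<Sum>b\<in>B. W (fst x) b))"
    by (simp add: sum_sign_patterns[OF finite_blocks(2) card_blocks(2)])
  also have "\<dots> = real (k choose i) * (\<Sum>a\<in>A. real (l choose j) * (\<Sum>b\<in>B. W a b))"
    by (rule sum_sign_patterns[OF finite_blocks(1) card_blocks(1)])
  finally show ?thesis
    by (simp add: sum_distrib_left mult.assoc)
qed

lemma cell_interior_coefficients:
  assumes pats: "(a, F) \<in> sign_patterns A i" "(b, G) \<in> sign_patterns B j"
    and x: "x \<in> interior (cell ((a, F), (b, G)))"
  obtains c where "x = (\<Sum>m\<in>A \<union> B. c m *\<^sub>R p m)" "W a b \<noteq> 0"
    "c a = 0" "\<And>m. m \<in> F \<Longrightarrow> c m < 0" "\<And>m. m \<in> A - {a} - F \<Longrightarrow> 0 < c m"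
    "c b = 0" "\<And>m. m \<in> G \<Longrightarrow> c m < 0" "\<And>m. m \<in> B - {b} - G \<Longrightarrow> 0 < c m"
proof -
  let ?J = "A \<union> B - {a, b}" and ?q = "flip (F \<union> G) p"
  have ab: "a \<in> A" "b \<in> B" "F \<subseteq> A - {a}" "G \<subseteq> B - {b}"
    using pats by (auto simp: mem_sign_patterns)
  have J: "finite ?J" "card ?J = DIM('a)"
    using finite_blocks card_minus2 ab by auto
  have "interior (cell ((a, F), (b, G))) \<noteq> {}"
    using x by auto
  then have "\<not> negligible (cell ((a, F), (b, G)))"
    using negligible_subset interior_subset open_not_negligible open_interior by metis
  then have W: "W a b \<noteq> 0"
    using measure_cell[OF pats] compact_cell[of "((a, F), (b, G))"]
    by (metis lmeasurable_compact negligible_iff_measure)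
  then have ne: "measure lebesgue (convex hull (insert 0 (?q ` ?J))) \<noteq> 0"
    using measure_cell[OF pats] by (simp add: cell_def)
  obtain e where e: "x = (\<Sum>m\<in>?J. e m *\<^sub>R ?q m)" "\<forall>m\<in>?J. 0 < e m"
    using origin_simplex_interior[OF J ne] x by (auto simp: cell_def)
  define c where "c m = (if m = a \<or> m = b then 0 else if m \<in> F \<union> G then - e m else e m)" for m
  have "x = (\<Sum>m\<in>?J. c m *\<^sub>R p m)"
    unfolding e(1) by (intro sum.cong) (auto simp: c_def flip_def)
  also have "\<dots> = (\<Sum>m\<in>A \<union> B. c m *\<^sub>R p m)"
    by (rule sum_minus2) (auto simp: c_def)
  finally show thesis
    by (rule that) (use W ab e(2) disjoint in \<open>auto simp: c_def\<close>)
qed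

text \<open>Two signed representations of a common interior point differ by a constant on each
  block, and a pattern with a fixed number of negative signs is unique under such shifts.\<close>

lemma disjoint_cell_interiors:
  assumes x: "x \<in> sign_patterns A i \<times> sign_patterns B j" and y: "y \<in> sign_patterns A i \<times> sign_patterns B j" and "x \<noteq> y"
  shows "interior (cell x) \<inter> interior (cell y) = {}"
proof (rule ccontr)
  obtain a F b G a' F' b' G' where xy: "x = ((a, F), (b, G))" "y = ((a', F'), (b', G'))"
    by (metis prod.exhaust)
  have pats: "(a, F) \<in> sign_patterns A i" "(b, G) \<in> sign_patterns B j" "(a', F') \<in> sign_patterns A i" "(b', G') \<in> sign_patterns B j"
    using x y xy by auto
  assume "interior (cell x) \<inter> interior (cell y) \<noteq> {}"
  then obtain z where z: "z \<in> interior (cell ((a, F), (b, G)))" "z \<in> interior (cell ((a', F'), (b', G')))"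
    using xy by auto
  obtain c where c: "z = (\<Sum>m\<in>A \<union> B. c m *\<^sub>R p m)" "W a b \<noteq> 0"
    "c a = 0" "\<And>m. m \<in> F \<Longrightarrow> c m < 0" "\<And>m. m \<in> A - {a} - F \<Longrightarrow> 0 < c m"
    "c b = 0" "\<And>m. m \<in> G \<Longrightarrow> c m < 0" "\<And>m. m \<in> B - {b} - G \<Longrightarrow> 0 < c m"
    using cell_interior_coefficients[OF pats(1,2) z(1)] by blast
  obtain c' where c': "z = (\<Sum>m\<in>A \<union> B. c' m *\<^sub>R p m)" "W a' b' \<noteq> 0"
    "c' a' = 0" "\<And>m. m \<in> F' \<Longrightarrow> c' m < 0" "\<And>m. m \<in> A - {a'} - F' \<Longrightarrow> 0 < c' m"
    "c' b' = 0" "\<And>m. m \<in> G' \<Longrightarrow> c' m < 0" "\<And>m. m \<in> B - {b'} - G' \<Longrightarrow> 0 < c' m"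
    using cell_interior_coefficients[OF pats(3,4) z(2)] by blast
  define d where "d m = c' m - c m" for m
  have "(\<Sum>m\<in>A \<union> B. d m *\<^sub>R p m) = 0"
    using c(1) c'(1) by (simp add: d_def scaleR_diff_left sum_subtractf)
  then have d: "d m = (if m \<in> A then d a else d b)" if "m \<in> A \<union> B" for m
    using relation_constant_on_blocks[of a b d m] pats c(2) that by (auto simp: mem_sign_patterns)
  have dA: "c' m = c m + d a" if "m \<in> A" for m
    using d[of m] that by (simp add: d_def)
  have dB: "c' m = c m + d b" if "m \<in> B" for m
  proof -
    have "m \<notin> A" using that disjoint by auto
    with d[of m] that show ?thesis by (simp add: d_def)
  qed
  have "a' = a \<and> F' = F"
    by (rule sign_patterns_shift_unique[OF finite_blocks(1) pats(1,3) c(3-5) c'(3-5) dA])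
  moreover have "b' = b \<and> G' = G"
    by (rule sign_patterns_shift_unique[OF finite_blocks(2) pats(2,4) c(6-8) c'(6-8) dB])
  ultimately show False
    using \<open>x \<noteq> y\<close> xy by simp
qed

text \<open>Every choice of \<open>i\<close> and \<open>j\<close> gives cells with disjoint
  interiors. With \<open>i = j = 0\<close> no vertex is negated and the cells fit into the
  unsymmetrised hull; central values give the largest count in the symmetric hull.\<close>

lemma packing:
  assumes X: "compact X" "convex X" "0 \<in> X"
    and vert: "\<And>a F b G. (a, F) \<in> sign_patterns A i \<Longrightarrow> (b, G) \<in> sign_patterns B j \<Longrightarrow>
       flip (F \<union> G) p ` (A \<union> B - {a, b}) \<subseteq> X"
  shows "real (k choose i) * real (l choose j) * (\<Sum>a\<in>A. \<Sum>b\<in>B. W a b) \<le> measure lebesgue X"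
proof -
  let ?S = "sign_patterns A i \<times> sign_patterns B j"
  have fin: "finite ?S"
    using finite_blocks by (simp add: finite_sign_patterns)
  have sub: "cell x \<subseteq> X" if "x \<in> ?S" for x
  proof -
    obtain a F b G where "x = ((a, F), (b, G))"
      by (metis prod.exhaust)
    moreover from this have "insert 0 (flip (F \<union> G) p ` (A \<union> B - {a, b})) \<subseteq> X"
      using that vert[of a F b G] X by auto
    ultimately show ?thesis
      using X(2) by (simp add: cell_def hull_minimal)
  qed
  have cell: "measure lebesgue (interior (cell x)) = measure lebesgue (cell x)" for x
    using compact_cell by (intro measure_interior negligible_convex_frontier compact_imp_bounded)
      (auto simp: cell_def split: prod.split)
  have meas: "interior (cell x) \<in> lmeasurable" for x
    using compact_cell compact_imp_bounded by (intro lmeasurable_interior) blast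
  have "(\<Sum>x\<in>?S. measure lebesgue (cell x)) = measure lebesgue (\<Union>x\<in>?S. interior (cell x))"
    using disjoint_cell_interiors fin meas
    by (subst measure_UNION') (auto simp: cell pairwise_def disjnt_def)
  also have "\<dots> \<le> measure lebesgue X"
    using X sub interior_subset meas fin
    by (intro measure_mono_fmeasurable lmeasurable_compact) (blast, auto)
  finally show ?thesis
    by (simp add: sum_cells)
qed

lemma sym_hull_zero: "0 \<in> sym_hull p (A \<union> B)"
proof -
  obtain a where "a \<in> A" using card_blocks by fastforce
  then have "p a \<in> sym_hull p (A \<union> B)" "- p a \<in> sym_hull p (A \<union> B)"
    by (auto simp: sym_hull_def intro!: hull_inc)
  then have "(1/2) *\<^sub>R p a + (1/2) *\<^sub>R (- p a) \<in> sym_hull p (A \<union> B)"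
    by (intro convexD) (auto simp: sym_hull_def)
  then show ?thesis by simp
qed

lemma sym_hull_ge:
  "real (k choose i) * real (l choose j) * (\<Sum>a\<in>A. \<Sum>b\<in>B. W a b) \<le> measure lebesgue (sym_hull p (A \<union> B))"
proof (rule packing)
  show "compact (sym_hull p (A \<union> B))" using finite_blocks by (simp add: compact_sym_hull)
  show "convex (sym_hull p (A \<union> B))" by (simp add: sym_hull_def)
  show "0 \<in> sym_hull p (A \<union> B)" by (rule sym_hull_zero)
  fix a F b G
  have "p m \<in> sym_hull p (A \<union> B)" "- p m \<in> sym_hull p (A \<union> B)" if "m \<in> A \<union> B" for m
    using that by (auto simp: sym_hull_def intro!: hull_inc)
  then show "flip (F \<union> G) p ` (A \<union> B - {a, b}) \<subseteq> sym_hull p (A \<union> B)"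
    by (auto simp: flip_def)
qed

lemma convex_hull_ge: "(\<Sum>a\<in>A. \<Sum>b\<in>B. W a b) \<le> measure lebesgue (convex hull (p ` (A \<union> B)))"
proof -
  have "real (k choose 0) * real (l choose 0) * (\<Sum>a\<in>A. \<Sum>b\<in>B. W a b) \<le> measure lebesgue (convex hull (p ` (A \<union> B)))"
  proof (rule packing)
    show "compact (convex hull (p ` (A \<union> B)))"
      using finite_blocks by (simp add: compact_convex_hull_image)
    have "0 = (\<Sum>m\<in>A. (1 / card A) *\<^sub>R p m)"
      using balanced by (simp add: scaleR_sum_right[symmetric])
    also have "\<dots> \<in> convex hull (p ` (A \<union> B))"
      using finite_blocks card_blocks by (intro convex_sum) (auto intro!: hull_inc)
    finally show "0 \<in> convex hull (p ` (A \<union> B))" .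
    fix a F b G assume "(a, F) \<in> sign_patterns A 0" "(b, G) \<in> sign_patterns B 0"
    then have "F = {}" "G = {}"
      using finite_blocks by (auto simp: mem_sign_patterns card_eq_0_iff dest: finite_subset)
    then show "flip (F \<union> G) p ` (A \<union> B - {a, b}) \<subseteq> convex hull (p ` (A \<union> B))"
      by (auto simp: flip_def intro!: hull_inc)
  qed simp
  then show ?thesis by simp
qed

text \<open>Subtracting the least coefficient from the block \<open>B\<close> creates a zero at some
  \<open>b\<close> and keeps the others nonnegative; the origin takes up the lost weight. So the
  simplices with apex at the origin cover.\<close>

lemma facet_le:
  assumes a: "a \<in> A"
  shows "measure lebesgue (convex hull (p ` (A \<union> B - {a}))) \<le> (\<Sum>b\<in>B. W a b)"
proof -
  have sub: "convex hull (p ` (A \<union> B - {a})) \<subseteq> (\<Union>b\<in>B. convex hull (insert 0 (p ` (A \<union> B - {a, b}))))"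
  proof
    fix x assume "x \<in> convex hull (p ` (A \<union> B - {a}))"
    then obtain c where c: "x = (\<Sum>m\<in>A \<union> B - {a}. c m *\<^sub>R p m)" "\<forall>m\<in>A \<union> B - {a}. 0 \<le> c m" "sum c (A \<union> B - {a}) = 1"
      using finite_blocks by (auto simp: convex_hull_image_eq)
    have "B \<noteq> {}" using card_blocks by auto
    then obtain b where b: "b \<in> B" "\<And>m. m \<in> B \<Longrightarrow> c b \<le> c m"
      using finite_blocks ex_min_if_finite[of "c ` B"] by (force simp: not_less)
    have aB: "a \<notin> B" using a disjoint by auto
    \<comment> \<open>Only the block \<open>B\<close> is shifted. The value of \<open>c\<close> at
      \<open>a\<close> carries no information and is replaced by 0.\<close>
    define e where "e m = (if m = a then 0 else c m) - (if m \<in> A then 0 else c b)" for m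
    have "x = (\<Sum>m\<in>A \<union> B - {a}. (if m = a then 0 else c m) *\<^sub>R p m)"
      unfolding c(1) by (intro sum.cong) auto
    also have "\<dots> = (\<Sum>m\<in>A \<union> B. (if m = a then 0 else c m) *\<^sub>R p m)"
      using finite_blocks by (intro sum.mono_neutral_left) auto
    also have "\<dots> = (\<Sum>m\<in>A \<union> B. e m *\<^sub>R p m)"
      unfolding e_def by (rule shift_sum[symmetric])
    also have "\<dots> = (\<Sum>m\<in>A \<union> B - {a, b}. e m *\<^sub>R p m)"
      using a b aB disjoint by (intro sum_minus2[symmetric]) (auto simp: e_def)
    finally have x: "x = (\<Sum>m\<in>A \<union> B - {a, b}. e m *\<^sub>R p m)" .
    have e0: "0 \<le> e m" if "m \<in> A \<union> B - {a, b}" for m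
      using that b c(2) aB by (auto simp: e_def)
    have "c b \<ge> 0" using b aB c(2) by auto
    then have "sum e (A \<union> B - {a, b}) \<le> sum c (A \<union> B - {a, b})"
      by (intro sum_mono) (auto simp: e_def)
    also have "\<dots> \<le> sum c (A \<union> B - {a})"
      using c(2) finite_blocks by (intro sum_mono2) auto
    finally have "sum e (A \<union> B - {a, b}) \<le> 1" using c(3) by simp
    then have "x \<in> convex hull (insert 0 (p ` (A \<union> B - {a, b})))"
      unfolding x using finite_blocks e0 by (intro mem_convex_hull_insert_zero) auto
    with b show "x \<in> (\<Union>b\<in>B. convex hull (insert 0 (p ` (A \<union> B - {a, b}))))" by blast
  qed
  have meas: "convex hull (insert 0 (p ` (A \<union> B - {a, b}))) \<in> lmeasurable" for b
    using finite_blocks by (intro lmeasurable_compact compact_convex_hull_insert_zero) auto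
  have "measure lebesgue (convex hull (p ` (A \<union> B - {a}))) \<le> measure lebesgue (\<Union>b\<in>B. convex hull (insert 0 (p ` (A \<union> B - {a, b}))))"
    using finite_blocks meas
    by (intro measure_mono_fmeasurable[OF sub] fmeasurableD[OF lmeasurable_compact] compact_convex_hull_image fmeasurable.finite_UN) auto
  also have "\<dots> \<le> (\<Sum>b\<in>B. W a b)"
    unfolding W_def using finite_blocks meas by (intro measure_UNION_le) auto
  finally show ?thesis .
qed

text \<open>Central patterns also cover: shifting the coefficients on each block by a median does
  not increase their absolute sum, so the point lands in the cell of the resulting signs.\<close>

lemma sym_hull_le:
  "measure lebesgue (sym_hull p (A \<union> B)) \<le>
     real (k choose (k div 2)) * real (l choose (l div 2)) * (\<Sum>a\<in>A. \<Sum>b\<in>B. W a b)"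
proof -
  let ?S = "sign_patterns A (k div 2) \<times> sign_patterns B (l div 2)"
  have sub: "sym_hull p (A \<union> B) \<subseteq> (\<Union>x\<in>?S. cell x)"
  proof
    fix x assume "x \<in> sym_hull p (A \<union> B)"
    then obtain u :: "'i \<times> real \<Rightarrow> real" where u: "x = (\<Sum>y\<in>(A \<union> B) \<times> {1, -1}. u y *\<^sub>R (\<lambda>(m, s). s *\<^sub>R p m) y)"
      "\<forall>y\<in>(A \<union> B) \<times> {1, -1}. 0 \<le> u y" "sum u ((A \<union> B) \<times> {1, -1}) = 1"
      using finite_blocks unfolding sym_hull_eq by (subst (asm) convex_hull_image_eq) auto
    define c where "c m = u (m, 1) - u (m, -1)" for m
    have "x = (\<Sum>m\<in>A \<union> B. \<Sum>s\<in>{1,-1}. u (m, s) *\<^sub>R s *\<^sub>R p m)"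
      unfolding u(1) sum.cartesian_product by (intro sum.cong) auto
    also have "\<dots> = (\<Sum>m\<in>A \<union> B. c m *\<^sub>R p m)"
      by (simp add: c_def algebra_simps)
    finally have x: "x = (\<Sum>m\<in>A \<union> B. c m *\<^sub>R p m)" .
    have "(\<Sum>m\<in>A \<union> B. \<bar>c m\<bar>) \<le> (\<Sum>m\<in>A \<union> B. \<Sum>s\<in>{1,-1}. u (m, s))"
    proof (rule sum_mono)
      fix m assume "m \<in> A \<union> B"
      with u(2) have "0 \<le> u (m, 1)" "0 \<le> u (m, -1)" by auto
      then show "\<bar>c m\<bar> \<le> (\<Sum>s\<in>{1,-1}. u (m, s))" by (simp add: c_def)
    qed
    also have "\<dots> = 1"
      using u(3) unfolding sum.cartesian_product by simp
    finally have c1: "(\<Sum>m\<in>A. \<bar>c m\<bar>) + (\<Sum>m\<in>B. \<bar>c m\<bar>) \<le> 1"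
      using finite_blocks disjoint by (simp add: sum.union_disjoint)
    obtain a F where aF: "(a, F) \<in> sign_patterns A (k div 2)" "\<forall>m\<in>F. c m \<le> c a" "\<forall>m\<in>A - {a} - F. c a \<le> c m"
      using sign_patterns_rank_exists[OF finite_blocks(1), of "k div 2" c] card_blocks by (auto simp: less_Suc_eq_le)
    obtain b G where bG: "(b, G) \<in> sign_patterns B (l div 2)" "\<forall>m\<in>G. c m \<le> c b" "\<forall>m\<in>B - {b} - G. c b \<le> c m"
      using sign_patterns_rank_exists[OF finite_blocks(2), of "l div 2" c] card_blocks by (auto simp: less_Suc_eq_le)
    have ab: "a \<in> A" "b \<in> B" "F \<subseteq> A - {a}" "G \<subseteq> B - {b}"
      using aF bG by (auto simp: mem_sign_patterns)
    define e where "e m = c m - (if m \<in> A then c a else c b)" for m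
    have e0: "e a = 0" "e b = 0" using ab disjoint by (auto simp: e_def)
    have "x = (\<Sum>m\<in>A \<union> B. e m *\<^sub>R p m)"
      unfolding x e_def by (rule shift_sum[symmetric])
    also have "\<dots> = (\<Sum>m\<in>A \<union> B - {a, b}. e m *\<^sub>R p m)"
      by (intro sum_minus2[symmetric]) (auto simp: e0)
    also have "\<dots> = (\<Sum>m\<in>A \<union> B - {a, b}. \<bar>e m\<bar> *\<^sub>R flip (F \<union> G) p m)"
    proof (rule sum.cong)
      fix m assume m: "m \<in> A \<union> B - {a, b}"
      then have "if m \<in> F \<union> G then e m \<le> 0 else e m \<ge> 0"
        using aF bG ab disjoint by (auto simp: e_def)
      then show "e m *\<^sub>R p m = \<bar>e m\<bar> *\<^sub>R flip (F \<union> G) p m"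
        by (auto simp: flip_def split: if_splits)
    qed simp
    finally have x': "x = (\<Sum>m\<in>A \<union> B - {a, b}. \<bar>e m\<bar> *\<^sub>R flip (F \<union> G) p m)" .
    have "(\<Sum>m\<in>A \<union> B - {a, b}. \<bar>e m\<bar>) = (\<Sum>m\<in>A \<union> B. \<bar>e m\<bar>)"
      by (intro sum_minus2) (auto simp: e0)
    also have "\<dots> = (\<Sum>m\<in>A. \<bar>e m\<bar>) + (\<Sum>m\<in>B. \<bar>e m\<bar>)"
      using finite_blocks disjoint by (simp add: sum.union_disjoint)
    also have "(\<Sum>m\<in>A. \<bar>e m\<bar>) = (\<Sum>m\<in>A. \<bar>c m - c a\<bar>)"
      by (intro sum.cong) (auto simp: e_def)
    also have "(\<Sum>m\<in>B. \<bar>e m\<bar>) = (\<Sum>m\<in>B. \<bar>c m - c b\<bar>)"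
      using disjoint by (intro sum.cong) (auto simp: e_def)
    also have "(\<Sum>m\<in>A. \<bar>c m - c a\<bar>) + (\<Sum>m\<in>B. \<bar>c m - c b\<bar>) \<le> (\<Sum>m\<in>A. \<bar>c m\<bar>) + (\<Sum>m\<in>B. \<bar>c m\<bar>)"
      using aF bG finite_blocks card_blocks by (intro add_mono median_shift) auto
    also note c1
    finally have "x \<in> cell ((a, F), (b, G))"
      unfolding cell_def x' using finite_blocks by (auto intro!: mem_convex_hull_insert_zero)
    with aF bG show "x \<in> (\<Union>x\<in>?S. cell x)" by blast
  qed
  have fin: "finite ?S"
    using finite_blocks by (simp add: finite_sign_patterns)
  have meas: "cell x \<in> lmeasurable" for x
    by (intro lmeasurable_compact compact_cell)
  have "measure lebesgue (sym_hull p (A \<union> B)) \<le> measure lebesgue (\<Union>x\<in>?S. cell x)"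
    using finite_blocks meas fin
    by (intro measure_mono_fmeasurable[OF sub] fmeasurableD[OF lmeasurable_compact] compact_sym_hull fmeasurable.finite_UN) auto
  also have "\<dots> \<le> (\<Sum>x\<in>?S. measure lebesgue (cell x))"
    using fin meas by (intro measure_UNION_le) auto
  finally show ?thesis
    by (simp only: sum_cells)
qed

end

section \<open>Lower bounds for symmetric hulls\<close>

lemma affine_combination_exists:
  fixes p :: "'i \<Rightarrow> 'a::real_vector"
  assumes I: "finite I" and x: "x \<in> affine hull (p ` I)"
  shows "\<exists>c. sum c I = 1 \<and> (\<Sum>m\<in>I. c m *\<^sub>R p m) = x"
proof -
  let ?R = "{\<Sum>m\<in>I. c m *\<^sub>R p m | c. sum c I = (1::real)}"
  have "affine hull (p ` I) \<subseteq> ?R"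
  proof (rule hull_minimal)
    show "p ` I \<subseteq> ?R"
    proof
      fix x assume "x \<in> p ` I"
      then obtain m where m: "m \<in> I" "x = p m" by auto
      then have "x = (\<Sum>n\<in>I. (if n = m then 1 else 0) *\<^sub>R p n)"
        using I by (simp add: if_distrib[of "\<lambda>c. c *\<^sub>R _"] cong: if_cong)
      with m I show "x \<in> ?R"
        by (auto intro!: exI[of _ "\<lambda>n. if n = m then 1 else 0"])
    qed
    show "affine ?R"
      unfolding affine_def
    proof (intro ballI allI impI)
      fix x y and u v :: real
      assume "x \<in> ?R" "y \<in> ?R" and uv: "u + v = 1"
      then obtain c e where "x = (\<Sum>m\<in>I. c m *\<^sub>R p m)" "sum c I = 1" "y = (\<Sum>m\<in>I. e m *\<^sub>R p m)" "sum e I = 1"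
        by auto
      with uv show "u *\<^sub>R x + v *\<^sub>R y \<in> ?R"
        by (intro CollectI exI[of _ "\<lambda>m. u * c m + v * e m"])
          (auto simp: scaleR_sum_right scaleR_add_left sum.distrib sum_distrib_left[symmetric])
    qed
  qed
  with x show ?thesis by blast
qed

lemma affine_relation_exists:
  fixes p :: "'i \<Rightarrow> 'a::euclidean_space"
  assumes I: "finite I" "card I = DIM('a) + 2"
  shows "\<exists>\<beta>. relation p I \<beta> \<and> sum \<beta> I = 0 \<and> (\<exists>m\<in>I. \<beta> m \<noteq> 0)"
proof (cases "inj_on p I")
  case True
  have "affine_dependent (p ` I)"
    using I True by (intro affine_dependent_biggerset) (auto simp: card_image)
  then obtain u where u: "sum u (p ` I) = 0" "\<exists>v\<in>p ` I. u v \<noteq> 0" "(\<Sum>v\<in>p ` I. u v *\<^sub>R v) = 0"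
    using I affine_dependent_explicit_finite[of "p ` I"] by auto
  then show ?thesis
    using True by (intro exI[of _ "u \<circ> p"]) (auto simp: relation_def sum.reindex)
next
  case False
  then obtain m n where mn: "m \<in> I" "n \<in> I" "m \<noteq> n" "p m = p n"
    by (auto simp: inj_on_def)
  let ?\<beta> = "\<lambda>x. (if x = m then 1 else 0) - (if x = n then 1 else 0 :: real)"
  have "sum ?\<beta> I = 0"
    using I mn by (simp add: sum_subtractf)
  moreover have "relation p I ?\<beta>"
    using I mn by (simp add: relation_def scaleR_diff_left sum_subtractf if_distrib[of "\<lambda>c. c *\<^sub>R _"] cong: if_cong)
  moreover have "?\<beta> m \<noteq> 0"
    using mn by simp
  ultimately show ?thesis
    using mn(1) by blast
qed

lemma measure_nonzero_affine_hull:
  fixes p :: "'i \<Rightarrow> 'a::euclidean_space"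
  assumes "finite I" "measure lebesgue (convex hull (p ` I)) \<noteq> 0"
  shows "affine hull (p ` I) = UNIV"
proof -
  have "measure lebesgue (interior (convex hull (p ` I))) = measure lebesgue (convex hull (p ` I))"
    using assms by (intro measure_interior negligible_convex_frontier compact_imp_bounded)
      (auto simp: compact_convex_hull_image)
  with assms have "interior (convex hull (p ` I)) \<noteq> {}" by auto
  then have "affine hull (convex hull (p ` I)) = UNIV"
    by (rule affine_hull_nonempty_interior)
  then show ?thesis by (simp add: affine_hull_convex_hull)
qed

lemma flattensD:
  fixes p p' :: "'i \<Rightarrow> 'a::euclidean_space"
  assumes "flattens A I p p'"
  shows "measure lebesgue (sym_hull p' I) \<le> measure lebesgue (sym_hull p I)"
    "A \<subseteq> J \<Longrightarrow> J \<subseteq> I \<Longrightarrow> card J = Suc DIM('a) \<Longrightarrow>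
        measure lebesgue (convex hull (p ` J)) \<le> measure lebesgue (convex hull (p' ` J))"
  using assms unfolding flattens_def by auto

abbreviation (input) central_binomial :: "nat \<Rightarrow> nat" where
  "central_binomial k \<equiv> k choose (k div 2)"

text \<open>The origin joins as index \<open>None\<close>, giving blocks of sizes 1 and
  \<open>d + 1\<close>. The relation supported on \<open>None\<close> says that this point is the
  origin, and it survives the averaging. The simplex to be tracked contains the whole averaged
  block, and adjoining the origin leaves the symmetric hull within the original one.\<close>

theorem sym_hull_simplex_ge:
  fixes p :: "'i \<Rightarrow> 'a::euclidean_space"
  assumes A: "finite A" "card A = DIM('a) + 1"
  shows "real (central_binomial DIM('a)) * measure lebesgue (convex hull (p ` A)) \<le> measure lebesgue (sym_hull p A)"
proof (cases "measure lebesgue (convex hull (p ` A)) = 0")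
  case False
  let ?d = "DIM('a)"
  let ?A = "Some ` A" let ?B = "{None}" let ?I = "Some ` A \<union> {None}" let ?q = "case_option 0 p"
  obtain \<gamma> where \<gamma>: "sum \<gamma> A = 1" "(\<Sum>m\<in>A. \<gamma> m *\<^sub>R p m) = 0"
    using affine_combination_exists[OF A(1), of 0 p] measure_nonzero_affine_hull[OF A(1) False] by auto
  have I: "finite ?I" using A by simp
  have r1: "relation ?q ?I (case_option 0 \<gamma>)"
    using A \<gamma> by (simp add: relation_def sum.reindex)
  have r2: "relation ?q ?I (case_option 1 (\<lambda>_. 0))"
    using A by (simp add: relation_def sum.reindex)
  obtain q where q: "flattens ?A ?I ?q q" "relation q ?I (block_average ?A (case_option 0 \<gamma>))"
      "relation q ?I (block_average ?A (case_option 1 (\<lambda>_. 0)))"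
    using average_two_relations[OF I _ r1 r2, of ?A] by auto
  have av: "block_average ?A (case_option 0 \<gamma>) = case_option 0 (\<lambda>m. if m \<in> A then 1 / (real ?d + 1) else \<gamma> m)"
    using A \<gamma> by (auto simp: block_average_def fun_eq_iff sum.reindex card_image split: option.split)
  have av0: "block_average ?A (case_option 1 (\<lambda>_. 0)) = case_option 1 (\<lambda>_. 0)"
    using A by (auto simp: block_average_def fun_eq_iff sum.reindex split: option.split)
  have qN: "q None = 0"
    using q(3) A unfolding av0 by (simp add: relation_def sum.reindex)
  have "(1 / (real ?d + 1)) *\<^sub>R (\<Sum>m\<in>A. q (Some m)) = 0"
    using q(2) A unfolding av by (simp add: relation_def sum.reindex scaleR_sum_right qN)
  then have qA: "(\<Sum>m\<in>?A. q m) = 0"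
    using A by (simp add: sum.reindex)
  interpret blk: balanced_blocks q ?B ?A 0 ?d
    by unfold_locales (use A qN qA in \<open>auto simp: card_image\<close>)
  have Un: "?B \<union> ?A = ?I" by auto
  have "measure lebesgue (convex hull (p ` A)) = measure lebesgue (convex hull (?q ` ?A))"
    by (simp add: image_image)
  also have "\<dots> \<le> measure lebesgue (convex hull (q ` ?A))"
    by (rule flattensD(2)[OF q(1)]) (use A in \<open>auto simp: card_image\<close>)
  also have "\<dots> \<le> (\<Sum>b\<in>?A. blk.W None b)"
    using blk.facet_le[of None] by simp
  finally have "real (central_binomial ?d) * measure lebesgue (convex hull (p ` A)) \<le>
     real (central_binomial ?d) * (\<Sum>b\<in>?A. blk.W None b)"
    by (intro mult_left_mono) auto
  also have "\<dots> \<le> measure lebesgue (sym_hull q ?I)"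
    using blk.sym_hull_ge[of 0 "?d div 2"] unfolding Un by simp
  also have "\<dots> \<le> measure lebesgue (sym_hull ?q ?I)"
    by (rule flattensD(1)[OF q(1)])
  also have "\<dots> \<le> measure lebesgue (sym_hull p A)"
  proof (rule measure_mono_fmeasurable)
    obtain a where "a \<in> A" using A by fastforce
    then have "p a \<in> sym_hull p A" "- p a \<in> sym_hull p A"
      by (auto simp: sym_hull_def intro!: hull_inc)
    then have "(1/2) *\<^sub>R p a + (1/2) *\<^sub>R (- p a) \<in> sym_hull p A"
      by (intro convexD) (auto simp: sym_hull_def)
    then have "0 \<in> sym_hull p A" by simp
    moreover have "p m \<in> sym_hull p A" "- p m \<in> sym_hull p A" if "m \<in> A" for m
      using that by (auto simp: sym_hull_def intro!: hull_inc)
    ultimately show "sym_hull ?q ?I \<subseteq> sym_hull p A"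
      unfolding sym_hull_def[of ?q] by (intro hull_minimal) (auto simp: sym_hull_def)
  qed (use A in \<open>auto intro!: fmeasurableD[OF lmeasurable_compact] lmeasurable_compact compact_sym_hull\<close>)
  finally show ?thesis .
qed simp

text \<open>Moving the coefficients along the affine relation until the first of them vanishes drops
  a vertex with negative \<open>\<beta>\<close>. The minimal ratio \<open>- c b / \<beta> b\<close>
  is that stopping time.\<close>

lemma convex_hull_covered:
  fixes p :: "'i \<Rightarrow> 'a::euclidean_space"
  assumes I: "finite I" and rel: "relation p I \<beta>" and sum0: "sum \<beta> I = 0" and nz: "\<exists>m\<in>I. \<beta> m \<noteq> 0"
  shows "measure lebesgue (convex hull (p ` I)) \<le>
    (\<Sum>b\<in>{m\<in>I. \<beta> m < 0}. measure lebesgue (convex hull (p ` (I - {b}))))"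
proof -
  let ?B = "{m\<in>I. \<beta> m < 0}"
  have B: "finite ?B" "?B \<noteq> {}"
  proof -
    show "?B \<noteq> {}"
    proof
      assume "?B = {}"
      then have "\<forall>m\<in>I. 0 \<le> \<beta> m" by (auto simp: not_less)
      with sum0 nz I show False by (simp add: sum_nonneg_eq_0_iff)
    qed
  qed (use I in simp)
  have sub: "convex hull (p ` I) \<subseteq> (\<Union>b\<in>?B. convex hull (p ` (I - {b})))"
  proof
    fix x assume "x \<in> convex hull (p ` I)"
    then obtain c where c: "x = (\<Sum>m\<in>I. c m *\<^sub>R p m)" "\<forall>m\<in>I. 0 \<le> c m" "sum c I = 1"
      using I by (auto simp: convex_hull_image_eq)
    obtain b where b: "b \<in> ?B" "\<And>m. m \<in> ?B \<Longrightarrow> - c b / \<beta> b \<le> - c m / \<beta> m"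
      using B ex_min_if_finite[of "(\<lambda>m. - c m / \<beta> m) ` ?B"] by (force simp: not_less)
    define t where "t = - c b / \<beta> b"
    define e where "e m = c m + t * \<beta> m" for m
    have t: "t \<ge> 0" using b c(2) by (auto simp: t_def divide_nonneg_neg)
    have eb: "e b = 0" using b by (simp add: e_def t_def)
    have e0: "0 \<le> e m" if m: "m \<in> I" for m
    proof (cases "\<beta> m < 0")
      case True
      then have "t \<le> - c m / \<beta> m" using b(2)[of m] m by (simp add: t_def)
      then show ?thesis using True by (simp add: e_def field_simps)
    next
      case False
      then show ?thesis using c(2) m t by (simp add: e_def)
    qed
    have bI: "b \<in> I" using b by simp
    have "sum e I = 1"
      using c(3) sum0 by (simp add: e_def sum.distrib sum_distrib_left[symmetric])
    then have e1: "sum e (I - {b}) = 1"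
      using I bI eb by (simp add: sum.remove)
    have "(\<Sum>m\<in>I. e m *\<^sub>R p m) = x + t *\<^sub>R (\<Sum>m\<in>I. \<beta> m *\<^sub>R p m)"
      by (simp add: e_def c(1) scaleR_add_left sum.distrib scaleR_sum_right)
    then have "x = (\<Sum>m\<in>I. e m *\<^sub>R p m)"
      using rel by (simp add: relation_def)
    also have "\<dots> = (\<Sum>m\<in>I - {b}. e m *\<^sub>R p m)"
      using I bI eb by (simp add: sum.remove)
    finally have "x \<in> convex hull (p ` (I - {b}))"
      using I e0 e1 by (auto simp: convex_hull_image_eq)
    with b show "x \<in> (\<Union>b\<in>?B. convex hull (p ` (I - {b})))" by blast
  qed
  have meas: "convex hull (p ` (I - {b})) \<in> lmeasurable" for b
    using I by (intro lmeasurable_compact compact_convex_hull_image) simp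
  have "measure lebesgue (convex hull (p ` I)) \<le> measure lebesgue (\<Union>b\<in>?B. convex hull (p ` (I - {b})))"
    using I meas B
    by (intro measure_mono_fmeasurable[OF sub] fmeasurableD[OF lmeasurable_compact] compact_convex_hull_image fmeasurable.finite_UN) auto
  also have "\<dots> \<le> (\<Sum>b\<in>?B. measure lebesgue (convex hull (p ` (I - {b}))))"
    using B meas by (intro measure_UNION_le) auto
  finally show ?thesis .
qed

theorem sym_hull_two_blocks_ge:
  fixes p :: "'i \<Rightarrow> 'a::euclidean_space"
  assumes I: "finite I" "card I = DIM('a) + 2"
  shows "\<exists>k l. k + l = DIM('a) \<and>
    real (central_binomial k) * real (central_binomial l) * measure lebesgue (convex hull (p ` I)) \<le> measure lebesgue (sym_hull p I)"
proof (cases "measure lebesgue (convex hull (p ` I)) = 0")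
  case True
  then show ?thesis by (intro exI[of _ "DIM('a)"] exI[of _ 0]) simp
next
  case False
  obtain \<beta> where \<beta>: "relation p I \<beta>" "sum \<beta> I = 0" "\<exists>m\<in>I. \<beta> m \<noteq> 0"
    using affine_relation_exists[OF I] by blast
  obtain \<gamma> where \<gamma>: "sum \<gamma> I = 1" "relation p I \<gamma>"
    using affine_combination_exists[OF I(1), of 0 p] measure_nonzero_affine_hull[OF I(1) False]
    by (auto simp: relation_def)
  \<comment> \<open>Indices with zero Radon coefficient are put into \<open>A\<close>. As
    \<open>A\<close> has positive total coefficient, averaging makes all coefficients on it strictly
    positive.\<close>
  define A B where "A = {m\<in>I. \<not> \<beta> m < 0}" and "B = {m\<in>I. \<beta> m < 0}"
  have AB: "A \<union> B = I" "A \<inter> B = {}" "A \<subseteq> I" "B \<subseteq> I" by (auto simp: A_def B_def)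
  have fin: "finite A" "finite B" using I by (auto simp: A_def B_def)
  have split: "sum f I = sum f A + sum f B" for f :: "'i \<Rightarrow> real"
    using fin AB by (metis sum.union_disjoint)
  have splitv: "sum f I = sum f A + sum f B" for f :: "'i \<Rightarrow> 'a"
    using fin AB by (metis sum.union_disjoint)
  have Bne: "B \<noteq> {}"
  proof
    assume "B = {}"
    then have "\<forall>m\<in>I. 0 \<le> \<beta> m" by (auto simp: B_def not_less)
    with \<beta> I show False by (simp add: sum_nonneg_eq_0_iff)
  qed
  then have "0 < (\<Sum>m\<in>B. - \<beta> m)"
    using fin by (intro sum_pos) (auto simp: B_def)
  then have \<beta>B: "sum \<beta> B < 0"
    by (simp add: sum_negf)
  then have \<beta>A: "sum \<beta> A > 0"
    using split[of \<beta>] \<beta>(2) by simp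
  then have Ane: "A \<noteq> {}" by auto
  have cardA: "card A > 0" "card B > 0" using Ane Bne fin by (auto simp: card_gt_0_iff)
  define k l where "k = card A - 1" and "l = card B - 1"
  have kl: "card A = Suc k" "card B = Suc l" using cardA by (auto simp: k_def l_def)
  have dim: "k + l = DIM('a)"
    using I(2) card_Un_disjoint[OF fin AB(2)] AB(1) kl by simp
  define m where "m q x = measure lebesgue (convex hull (q ` (I - {x})))" for q :: "'i \<Rightarrow> 'a" and x
  have cardI: "card (I - {x}) = Suc DIM('a)" if "x \<in> I" for x
    using I that by simp

  obtain p1 where p1: "flattens A I p p1" "relation p1 I (block_average A \<beta>)" "relation p1 I (block_average A \<gamma>)"
    using average_two_relations[OF I(1) AB(3) \<beta>(1) \<gamma>(2)] by blast
  define \<beta>1 \<gamma>1 where "\<beta>1 = block_average A \<beta>" and "\<gamma>1 = block_average A \<gamma>"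
  obtain p2 where p2: "flattens B I p1 p2" "relation p2 I (block_average B \<beta>1)" "relation p2 I (block_average B \<gamma>1)"
    using average_two_relations[OF I(1) AB(4) p1(2,3)] unfolding \<beta>1_def \<gamma>1_def by blast

  have sum1: "sum (block_average A f) A = sum f A" "sum (block_average A f) B = sum f B" for f
    using fin AB by (auto simp: sum_block_average block_average_def intro!: sum.cong)
  \<comment> \<open>Switching families: summing this identity over all pairs and using that the
    coefficients of \<open>\<beta>1\<close> on \<open>A\<close> and \<open>B\<close> have opposite
    totals shows that both families have the same total volume.\<close>
  have ratio: "\<bar>\<beta>1 a\<bar> * m p1 b = \<bar>\<beta>1 b\<bar> * m p1 a" if "a \<in> A" "b \<in> B" for a b
    unfolding m_def \<beta>1_def
    by (rule simplex_measure_ratio[OF I _ _ p1(2)]) (use that AB \<beta>(2) in \<open>auto simp: split sum1\<close>)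
  have \<beta>1A: "\<bar>\<beta>1 a\<bar> = \<beta>1 a" if "a \<in> A" for a
    using that \<beta>A by (simp add: \<beta>1_def block_average_def)
  have \<beta>1B: "\<bar>\<beta>1 b\<bar> = - \<beta>1 b" if "b \<in> B" for b
    using that AB(2) by (auto simp: \<beta>1_def block_average_def B_def)
  have "(\<Sum>a\<in>A. \<beta>1 a) * (\<Sum>b\<in>B. m p1 b) = (\<Sum>a\<in>A. \<Sum>b\<in>B. \<bar>\<beta>1 a\<bar> * m p1 b)"
    by (simp add: sum_product \<beta>1A)
  also have "\<dots> = (\<Sum>a\<in>A. \<Sum>b\<in>B. \<bar>\<beta>1 b\<bar> * m p1 a)"
    by (intro sum.cong refl ratio) auto
  also have "\<dots> = (\<Sum>a\<in>A. \<Sum>b\<in>B. m p1 a * (- \<beta>1 b))"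
    by (intro sum.cong refl) (simp add: \<beta>1B)
  also have "\<dots> = (\<Sum>a\<in>A. m p1 a) * (\<Sum>b\<in>B. - \<beta>1 b)"
    by (simp only: sum_product)
  also have "(\<Sum>b\<in>B. - \<beta>1 b) = (\<Sum>a\<in>A. \<beta>1 a)"
    using split[of \<beta>] \<beta>(2) by (simp add: sum_negf \<beta>1_def sum1)
  finally have AB_eq: "(\<Sum>b\<in>B. m p1 b) = (\<Sum>a\<in>A. m p1 a)"
    using \<beta>A by (simp add: \<beta>1_def sum1)

  define SA SB where "SA = (\<Sum>x\<in>A. p2 x)" and "SB = (\<Sum>x\<in>B. p2 x)"
  have rel2: "(sum f A / card A) *\<^sub>R SA + (sum f B / card B) *\<^sub>R SB = 0"
    if "relation p2 I (block_average B (block_average A f))" for f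
  proof -
    have "0 = (\<Sum>x\<in>A. block_average B (block_average A f) x *\<^sub>R p2 x) + (\<Sum>x\<in>B. block_average B (block_average A f) x *\<^sub>R p2 x)"
      using that by (simp add: relation_def splitv)
    also have "(\<Sum>x\<in>A. block_average B (block_average A f) x *\<^sub>R p2 x) = (\<Sum>x\<in>A. (sum f A / card A) *\<^sub>R p2 x)"
      using AB(2) by (intro sum.cong refl) (auto simp: block_average_def)
    also have "(\<Sum>x\<in>B. block_average B (block_average A f) x *\<^sub>R p2 x) = (\<Sum>x\<in>B. (sum f B / card B) *\<^sub>R p2 x)"
      using AB(2) sum1(2)[of f] by (intro sum.cong refl) (auto simp: block_average_def[of B])
    finally show ?thesis by (simp add: SA_def SB_def scaleR_sum_right)
  qed
  \<comment> \<open>The averaged \<open>\<beta>\<close> equates the means of the two blocks. The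
    averaged \<open>\<gamma>\<close>, whose coefficients sum to 1, then makes the common mean
    zero.\<close>
  define s where "s = sum \<beta> A"
  have s: "s > 0" "sum \<beta> B = - s"
    using \<beta>A split[of \<beta>] \<beta>(2) by (auto simp: s_def)
  have "s *\<^sub>R ((1 / card A) *\<^sub>R SA - (1 / card B) *\<^sub>R SB) = 0"
    using rel2[OF p2(2)[unfolded \<beta>1_def]] s by (simp add: s_def[symmetric] scaleR_diff_right)
  then have mean: "(1 / card A) *\<^sub>R SA = (1 / card B) *\<^sub>R SB"
    using s by simp
  have "sum \<gamma> A *\<^sub>R ((1 / card A) *\<^sub>R SA) + sum \<gamma> B *\<^sub>R ((1 / card B) *\<^sub>R SB) = 0"
    using rel2[OF p2(3)[unfolded \<gamma>1_def]] by simp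
  then have "(sum \<gamma> A + sum \<gamma> B) *\<^sub>R ((1 / card A) *\<^sub>R SA) = 0"
    by (simp only: mean scaleR_add_left)
  then have "(1 / card A) *\<^sub>R SA = 0"
    using \<gamma>(1) split[of \<gamma>] by simp
  with mean have S0: "SA = 0" "SB = 0"
    using cardA by auto

  interpret blk: balanced_blocks p2 A B k l
    by unfold_locales (use fin AB kl dim S0 in \<open>auto simp: SA_def SB_def\<close>)
  have "measure lebesgue (convex hull (p ` I)) \<le> (\<Sum>b\<in>B. m p b)"
    unfolding m_def B_def by (rule convex_hull_covered[OF I(1) \<beta>])
  also have "\<dots> \<le> (\<Sum>b\<in>B. m p1 b)"
    unfolding m_def by (intro sum_mono flattensD(2)[OF p1(1)]) (use AB cardI in \<open>auto simp: B_def\<close>)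
  also note AB_eq
  also have "(\<Sum>a\<in>A. m p1 a) \<le> (\<Sum>a\<in>A. m p2 a)"
    unfolding m_def by (intro sum_mono flattensD(2)[OF p2(1)]) (use AB cardI in \<open>auto simp: A_def\<close>)
  also have "\<dots> \<le> (\<Sum>a\<in>A. \<Sum>b\<in>B. blk.W a b)"
    unfolding m_def using blk.facet_le AB(1) by (intro sum_mono) auto
  finally have "real (central_binomial k) * real (central_binomial l) * measure lebesgue (convex hull (p ` I)) \<le>
      real (central_binomial k) * real (central_binomial l) * (\<Sum>a\<in>A. \<Sum>b\<in>B. blk.W a b)"
    by (intro mult_left_mono) auto
  also have "\<dots> \<le> measure lebesgue (sym_hull p2 I)"
    using blk.sym_hull_ge[of "k div 2" "l div 2"] AB(1) by simp
  also have "\<dots> \<le> measure lebesgue (sym_hull p1 I)"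
    by (rule flattensD(1)[OF p2(1)])
  also have "\<dots> \<le> measure lebesgue (sym_hull p I)"
    by (rule flattensD(1)[OF p1(1)])
  finally show ?thesis
    using dim by blast
qed

section \<open>Products of central binomial coefficients\<close>

lemma central_binomial_odd: "(2 * j + 1 choose j) * (j + 1) = (2 * j choose j) * (2 * j + 1)"
proof -
  have "(2 * j + 1 choose j) = (2 * j + 1 choose (j + 1))"
    using binomial_symmetric[of j "2 * j + 1"] by simp
  then show ?thesis
    using Suc_times_binomial_eq[of "2 * j" j] by (simp add: mult.commute)
qed

lemma central_binomial_even: "(2 * j + 2 choose (j + 1)) = 2 * (2 * j + 1 choose j)"
proof -
  have "(2 * j + 1 choose j) = (2 * j + 1 choose (j + 1))"
    using binomial_symmetric[of j "2 * j + 1"] by simp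
  then show ?thesis by simp
qed

text \<open>For both parities, the growth factor over two steps is \<open>4 - 2 / (i + 1)\<close>
  with \<open>i = (k + 1) div 2\<close>, which is nondecreasing in \<open>k\<close>.\<close>

lemma central_binomial_step:
  "central_binomial (k + 2) * ((k + 1) div 2 + 1) = central_binomial k * (2 * (2 * ((k + 1) div 2) + 1))"
proof (cases "even k")
  case True
  then obtain j where k: "k = 2 * j" by (elim evenE)
  have "central_binomial (k + 2) = 2 * (2 * j + 1 choose j)"
    using central_binomial_even[of j] by (simp add: k)
  moreover have "(k + 1) div 2 = j" "k div 2 = j" by (auto simp: k)
  ultimately show ?thesis
    using central_binomial_odd[of j] by (simp add: k algebra_simps)
next
  case False
  then obtain i where k: "k = 2 * i + 1" by (elim oddE)
  have "central_binomial (k + 2) * (i + 2) = (2 * (i + 1) choose (i + 1)) * (2 * (i + 1) + 1)"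
    using central_binomial_odd[of "i + 1"] by (simp add: k)
  moreover have "(2 * (i + 1) choose (i + 1)) = 2 * central_binomial k"
    using central_binomial_even[of i] by (simp add: k)
  moreover have "(k + 1) div 2 + 1 = i + 2" "2 * ((k + 1) div 2) = 2 * (i + 1)" by (auto simp: k)
  ultimately show ?thesis
    by (simp only: mult_ac)
qed

text \<open>Log-convexity in steps of two: bringing the indices closer by moving two units from the
  larger to the smaller does not increase the product.\<close>

lemma central_binomial_exchange:
  assumes "l \<le> k"
  shows "central_binomial k * central_binomial (l + 2) \<le> central_binomial (k + 2) * central_binomial l"
proof -
  define i j where "i = (k + 1) div 2" and "j = (l + 1) div 2"
  have ji: "j \<le> i" using assms by (auto simp: i_def j_def intro: div_le_mono)
  let ?f = "\<lambda>k. real (central_binomial k)"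
  have sk: "?f (k + 2) * real (i + 1) = ?f k * (2 * (2 * real i + 1))"
    using arg_cong[OF central_binomial_step[of k], of real] unfolding i_def by (simp only: of_nat_mult of_nat_add of_nat_numeral of_nat_1)
  have sl: "?f (l + 2) * real (j + 1) = ?f l * (2 * (2 * real j + 1))"
    using arg_cong[OF central_binomial_step[of l], of real] unfolding j_def by (simp only: of_nat_mult of_nat_add of_nat_numeral of_nat_1)
  have ratio: "(2 * (2 * real j + 1)) * real (i + 1) \<le> (2 * (2 * real i + 1)) * real (j + 1)"
    using ji by (simp add: algebra_simps)
  have "(?f k * ?f (l + 2)) * (real (i + 1) * real (j + 1)) = ?f k * real (i + 1) * (?f (l + 2) * real (j + 1))"
    by (simp only: mult_ac)
  also have "\<dots> = ?f k * ?f l * ((2 * (2 * real j + 1)) * real (i + 1))"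
    unfolding sl by (simp only: mult_ac)
  also have "\<dots> \<le> ?f k * ?f l * ((2 * (2 * real i + 1)) * real (j + 1))"
    using ratio by (intro mult_left_mono) auto
  also have "\<dots> = ?f k * (2 * (2 * real i + 1)) * (?f l * real (j + 1))"
    by (simp only: mult_ac)
  also have "\<dots> = (?f (k + 2) * ?f l) * (real (i + 1) * real (j + 1))"
    unfolding sk[symmetric] by (simp only: mult_ac)
  finally have "?f k * ?f (l + 2) \<le> ?f (k + 2) * ?f l"
    by (rule mult_right_le_imp_le) simp
  then show ?thesis
    by (simp only: of_nat_mult[symmetric] of_nat_le_iff)
qed

lemma central_binomial_odd_le: "(2 * j + 1 choose j) \<le> 2 * (2 * j choose j)"
proof -
  have "(2 * j + 1 choose j) * (j + 1) \<le> (2 * (2 * j choose j)) * (j + 1)"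
    unfolding central_binomial_odd by (simp add: algebra_simps)
  then show ?thesis by (simp only: mult_le_cancel2)
qed

text \<open>Exchanges reduce to index gaps 0, 1 and 2. For an even sum, gaps 0 and 2 compete and the
  pair of odd indices wins, because passing from \<open>2 * j + 1\<close> to
  \<open>2 * j + 2\<close> doubles the central binomial while passing from \<open>2 * j\<close> to
  \<open>2 * j + 1\<close> at most doubles it. This is the origin of \<open>2 * m + 1\<close> and
  \<open>2 * m + r - 1\<close>; positivity guards the truncated subtraction.\<close>

lemma central_binomial_product_min:
  assumes d: "k + l = 4 * m + r" and r: "r \<le> 3" and pos: "0 < 4 * m + r"
  shows "central_binomial (2 * m + 1) * central_binomial (2 * m + r - 1) \<le> central_binomial k * central_binomial l"
proof -
  have main: "central_binomial (2 * m + 1) * central_binomial (2 * m + r - 1) \<le> central_binomial k * central_binomial l"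
    if "l \<le> k" "k + l = 4 * m + r" for k l
    using that
  proof (induction k arbitrary: l rule: less_induct)
    case (less k)
    show ?case
    proof (cases "l + 3 \<le> k")
      case True
      \<comment> \<open>If \<open>k = l + 3\<close>, the new pair is out of order, and the induction
        hypothesis is applied with the roles exchanged.\<close>
      define k' where "k' = k - 2"
      have k': "k = k' + 2" "l \<le> k'" using True by (auto simp: k'_def)
      have "central_binomial (2 * m + 1) * central_binomial (2 * m + r - 1) \<le> central_binomial k' * central_binomial (l + 2)"
      proof (cases "l + 2 \<le> k'")
        case True
        then show ?thesis using less.IH[of k' "l + 2"] less.prems k' by simp
      next
        case False
        then show ?thesis using less.IH[of "l + 2" k'] less.prems k' True by (simp add: mult.commute)
      qed
      also have "\<dots> \<le> central_binomial k * central_binomial l"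
        using central_binomial_exchange[OF k'(2)] k'(1) by simp
      finally show ?thesis .
    next
      case False
      with less.prems consider "k = l" | "k = l + 1" | "k = l + 2" by linarith
      then show ?thesis
      proof cases
        case 1
        then have "even r" using less.prems by presburger
        then have "r = 0 \<or> r = 2" using r by presburger
        then show ?thesis
        proof
          assume r0: "r = 0"
          define n where "n = m - 1"
          have m: "m = n + 1" using pos r0 by (simp add: n_def)
          have l: "l = 2 * (n + 1)" using 1 less.prems r0 m by simp
          have "(2 * (n + 1) + 1 choose (n + 1)) * (2 * n + 1 choose n) \<le> (2 * (2 * (n + 1) choose (n + 1))) * (2 * n + 1 choose n)"
            using central_binomial_odd_le[of "n + 1"] by (rule mult_right_mono) simp
          also have "\<dots> = (2 * (n + 1) choose (n + 1)) * (2 * (n + 1) choose (n + 1))"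
            using central_binomial_even[of n] by (simp add: algebra_simps)
          finally show ?thesis
            using 1 by (simp add: l m r0)
        next
          assume "r = 2"
          then have "k = 2 * m + 1" using 1 less.prems by simp
          then show ?thesis using 1 \<open>r = 2\<close> by simp
        qed
      next
        case 2
        then have "odd r" using less.prems by presburger
        then have "r = 1 \<or> r = 3" using r by presburger
        then show ?thesis
        proof
          assume "r = 1"
          then have "l = 2 * m" "k = 2 * m + 1" using 2 less.prems by auto
          then show ?thesis using \<open>r = 1\<close> by simp
        next
          assume "r = 3"
          then have "l = 2 * m + 1" "k = 2 * m + 2" using 2 less.prems by auto
          then show ?thesis using \<open>r = 3\<close> by (simp add: mult.commute)
        qed
      next
        case 3
        then have "even r" using less.prems by presburger
        then have "r = 0 \<or> r = 2" using r by presburger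
        then show ?thesis
        proof
          assume "r = 0"
          then have "l = 2 * m - 1" "k = 2 * m + 1" using 3 less.prems by auto
          then show ?thesis using \<open>r = 0\<close> by simp
        next
          assume r2: "r = 2"
          then have l: "l = 2 * m" "k = 2 * m + 2" using 3 less.prems by auto
          have "(2 * m + 1 choose m) * (2 * m + 1 choose m) \<le> (2 * m + 1 choose m) * (2 * (2 * m choose m))"
            using central_binomial_odd_le[of m] by (rule mult_left_mono) simp
          also have "\<dots> = (2 * m + 2 choose (m + 1)) * (2 * m choose m)"
            using central_binomial_even[of m] by simp
          finally show ?thesis by (simp add: l r2)
        qed
      qed
    qed
  qed
  show ?thesis
  proof (cases "l \<le> k")
    case True
    then show ?thesis using main d by blast
  next
    case False
    then show ?thesis using main[of k l] d by (simp add: mult.commute)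
  qed
qed

section \<open>Busemann volume\<close>

lemma polytope_eq_hull_image:
  fixes Q :: "'a::euclidean_space set"
  assumes Q: "polytope Q" "Q \<noteq> {}" and n: "card (vertices Q) \<le> n"
  shows "\<exists>p. Q = convex hull (p ` {..<n})"
proof -
  have hull: "Q = convex hull (vertices Q)"
    unfolding vertices_def using Q(1)
    by (intro Krein_Milman_Minkowski polytope_imp_compact polytope_imp_convex)
  then have ne: "vertices Q \<noteq> {}" using Q(2) by auto
  obtain S where "finite S" "Q = convex hull S"
    using Q(1) by (auto simp: polytope_def)
  then have fin: "finite (vertices Q)"
    using extreme_point_of_convex_hull[of _ S] by (auto simp: vertices_def intro: finite_subset)
  obtain h where h: "bij_betw h {..<card (vertices Q)} (vertices Q)"
    using ex_bij_betw_nat_finite[OF fin] by (auto simp: atLeast0LessThan)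
  \<comment> \<open>A vertex is repeated to reach exactly \<open>n\<close> indices, so that
    polytopes with fewer vertices fall under the bounds for indexed families.\<close>
  define p where "p i = (if i < card (vertices Q) then h i else h 0)" for i
  have pos: "0 < card (vertices Q)" using fin ne by (simp add: card_gt_0_iff)
  have "p ` {..<n} = h ` {..<card (vertices Q)}"
    using n pos by (auto simp: p_def image_iff)
  with h hull show ?thesis
    by (metis bij_betw_imp_surj_on)
qed

lemma sym_hull_subset:
  assumes "B \<in> sym_convex_bodies" "convex hull (p ` I) \<subseteq> B"
  shows "sym_hull p I \<subseteq> B"
proof -
  have "p ` I \<subseteq> B" using assms(2) hull_subset[of "p ` I" convex] by auto
  moreover from this have "uminus ` p ` I \<subseteq> B"
    using assms(1) by (auto simp: sym_convex_bodies_def)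
  ultimately show ?thesis
    using assms(1) by (simp add: sym_hull_def sym_convex_bodies_def hull_minimal)
qed

lemma measure_sym_convex_body_pos:
  assumes "B \<in> sym_convex_bodies"
  shows "0 < measure lebesgue B"
proof -
  have B: "B \<in> lmeasurable" "interior B \<noteq> {}"
    using assms by (auto simp: sym_convex_bodies_def lmeasurable_compact)
  then have "\<not> negligible B"
    using negligible_subset interior_subset open_not_negligible open_interior by metis
  with B show ?thesis
    using negligible_iff_measure by (metis zero_less_measure_iff)
qed

text \<open>A volume bound valid for all bodies, together with one pair attaining it, determines
  both suprema: \<open>C\<close> is the least possible ratio of volumes.\<close>

lemma Bus_extremal:
  fixes C :: real
  assumes C: "0 < C"
    and bound: "\<And>(B :: (real ^ 'd) set) Q. B \<in> sym_convex_bodies \<Longrightarrow> polytope Q \<Longrightarrow> Q \<noteq> {} \<Longrightarrow> Q \<subseteq> B \<Longrightarrow>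
       card (vertices Q) \<le> n \<Longrightarrow> C * measure lebesgue Q \<le> measure lebesgue B"
    and B: "(B :: (real ^ 'd) set) \<in> sym_convex_bodies"
    and Q: "polytope Q" "Q \<subseteq> B" "card (vertices Q) \<le> n" "measure lebesgue B \<le> C * measure lebesgue Q"
  shows "mu_Bus n B = kappa TYPE('d) / C" and "M_Bus n TYPE('d) = kappa TYPE('d) / C"
proof -
  have k: "0 \<le> kappa TYPE('d)" by (simp add: kappa_def)
  have vol: "vol_Bus B' Q' \<le> kappa TYPE('d) / C"
    if "B' \<in> sym_convex_bodies" "polytope Q'" "Q' \<subseteq> B'" "card (vertices Q') \<le> n" for B' Q' :: "(real ^ 'd) set"
  proof (cases "Q' = {}")
    case True
    then show ?thesis using k C by (simp add: vol_Bus_def)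
  next
    case False
    have "kappa TYPE('d) * (C * measure lebesgue Q') \<le> kappa TYPE('d) * measure lebesgue B'"
      using bound[of B' Q'] that False k by (intro mult_left_mono) auto
    then show ?thesis
      using measure_sym_convex_body_pos[OF that(1)] C by (simp add: vol_Bus_def field_simps)
  qed
  have mu_le: "mu_Bus n B' \<le> kappa TYPE('d) / C" if "B' \<in> sym_convex_bodies" for B' :: "(real ^ 'd) set"
    unfolding mu_Bus_def by (rule cSup_least[OF mu_Bus_set_nonempty]) (use vol that in auto)
  have "kappa TYPE('d) * measure lebesgue B \<le> kappa TYPE('d) * (C * measure lebesgue Q)"
    using Q(4) k by (intro mult_left_mono)
  then have "kappa TYPE('d) / C \<le> vol_Bus B Q"
    using measure_sym_convex_body_pos[OF B] C by (simp add: vol_Bus_def field_simps)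
  also have "\<dots> \<le> mu_Bus n B"
    unfolding mu_Bus_def by (rule cSup_upper[OF _ mu_Bus_set_bdd_above[OF B]]) (use Q in auto)
  finally show mu: "mu_Bus n B = kappa TYPE('d) / C"
    using mu_le[OF B] by simp
  have "M_Bus n TYPE('d) \<le> kappa TYPE('d) / C"
    unfolding M_Bus_def by (rule cSup_least[OF M_Bus_set_nonempty]) (use mu_le in auto)
  moreover have "mu_Bus n B \<le> M_Bus n TYPE('d)"
    unfolding M_Bus_def by (rule cSup_upper[OF _ M_Bus_set_bdd_above]) (use B in auto)
  ultimately show "M_Bus n TYPE('d) = kappa TYPE('d) / C"
    using mu by simp
qed

lemma polytope_volume_bound_d_plus_1:
  fixes B Q :: "(real ^ 'd) set"
  assumes "B \<in> sym_convex_bodies" "polytope Q" "Q \<noteq> {}" "Q \<subseteq> B" "card (vertices Q) \<le> CARD('d) + 1"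
  shows "real (central_binomial CARD('d)) * measure lebesgue Q \<le> measure lebesgue B"
proof -
  obtain p where p: "Q = convex hull (p ` {..<CARD('d) + 1})"
    using polytope_eq_hull_image[OF assms(2,3,5)] by blast
  have "real (central_binomial CARD('d)) * measure lebesgue Q \<le> measure lebesgue (sym_hull p {..<CARD('d) + 1})"
    unfolding p using sym_hull_simplex_ge[of "{..<CARD('d) + 1}" p] by simp
  also have "\<dots> \<le> measure lebesgue B"
    using sym_hull_subset[OF assms(1)] assms p
    by (intro measure_mono_fmeasurable fmeasurableD[OF lmeasurable_compact] compact_sym_hull)
      (auto simp: sym_convex_bodies_def lmeasurable_compact)
  finally show ?thesis .
qed

lemma polytope_volume_bound_d_plus_2:
  fixes B Q :: "(real ^ 'd) set"
  assumes "B \<in> sym_convex_bodies" "polytope Q" "Q \<noteq> {}" "Q \<subseteq> B" "card (vertices Q) \<le> CARD('d) + 2"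
    and d: "CARD('d) = 4 * m + r" "r \<le> 3"
  shows "real (central_binomial (2 * m + 1) * central_binomial (2 * m + r - 1)) * measure lebesgue Q \<le> measure lebesgue B"
proof -
  obtain p where p: "Q = convex hull (p ` {..<CARD('d) + 2})"
    using polytope_eq_hull_image[OF assms(2,3,5)] by blast
  obtain k l where kl: "k + l = CARD('d)"
    "real (central_binomial k) * real (central_binomial l) * measure lebesgue Q \<le> measure lebesgue (sym_hull p {..<CARD('d) + 2})"
    unfolding p using sym_hull_two_blocks_ge[of "{..<CARD('d) + 2}" p] by auto
  have "0 < 4 * m + r" using d(1) by (metis zero_less_card_finite)
  then have "central_binomial (2 * m + 1) * central_binomial (2 * m + r - 1) \<le> central_binomial k * central_binomial l"
    using central_binomial_product_min[of k l m r] kl(1) d by simp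
  then have "real (central_binomial (2 * m + 1) * central_binomial (2 * m + r - 1)) * measure lebesgue Q
      \<le> real (central_binomial k * central_binomial l) * measure lebesgue Q"
    by (intro mult_right_mono of_nat_mono) auto
  also have "\<dots> \<le> measure lebesgue (sym_hull p {..<CARD('d) + 2})"
    using kl(2) by simp
  also have "\<dots> \<le> measure lebesgue B"
    using sym_hull_subset[OF assms(1)] assms p
    by (intro measure_mono_fmeasurable fmeasurableD[OF lmeasurable_compact] compact_sym_hull)
      (auto simp: sym_convex_bodies_def lmeasurable_compact)
  finally show ?thesis .
qed

section \<open>Extremal bodies\<close>

lemma sym_hull_in_sym_convex_bodies:
  fixes p :: "'i \<Rightarrow> real ^ 'd"
  assumes I: "finite I" and span: "span (p ` I) = UNIV"
  shows "sym_hull p I \<in> sym_convex_bodies"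
proof -
  have pm: "p m \<in> sym_hull p I" "- p m \<in> sym_hull p I" if "m \<in> I" for m
    using that by (auto simp: sym_hull_def intro!: hull_inc)
  have "interior (sym_hull p I) \<noteq> {}"
  proof
    assume "interior (sym_hull p I) = {}"
    then obtain a b where ab: "a \<noteq> 0" "sym_hull p I \<subseteq> {x. a \<bullet> x = b}"
      using empty_interior_subset_hyperplane[of "sym_hull p I"] by (auto simp: sym_hull_def)
    \<comment> \<open>A hyperplane containing both \<open>p m\<close> and \<open>- p m\<close>
      passes through the origin, so it would contain the whole span.\<close>
    have "a \<bullet> p m = 0" if "m \<in> I" for m
    proof -
      have "a \<bullet> p m = b" "a \<bullet> (- p m) = b" using pm[OF that] ab(2) by blast+
      then show ?thesis by simp
    qed
    then have "span (p ` I) \<subseteq> {x. a \<bullet> x = 0}"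
      by (intro span_minimal subspace_hyperplane) auto
    with span have "a \<bullet> a = 0" by blast
    with ab(1) show False by simp
  qed
  moreover have "uminus ` sym_hull p I = sym_hull p I"
  proof -
    have "uminus ` sym_hull p I = convex hull (uminus ` (p ` I \<union> uminus ` p ` I))"
      unfolding sym_hull_def by (simp add: convex_hull_linear_image linear_uminus)
    also have "uminus ` (p ` I \<union> uminus ` p ` I) = p ` I \<union> uminus ` p ` I"
      by (auto simp: image_Un image_image)
    finally show ?thesis by (simp add: sym_hull_def)
  qed
  ultimately show ?thesis
    using I by (simp add: sym_convex_bodies_def compact_sym_hull) (simp add: sym_hull_def)
qed

lemma card_vertices_hull_image:
  fixes p :: "'i \<Rightarrow> 'a::euclidean_space"
  assumes "finite I"
  shows "card (vertices (convex hull (p ` I))) \<le> card I"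
proof -
  have "vertices (convex hull (p ` I)) \<subseteq> p ` I"
    using extreme_point_of_convex_hull by (auto simp: vertices_def)
  then have "card (vertices (convex hull (p ` I))) \<le> card (p ` I)"
    using assms by (intro card_mono) auto
  also have "\<dots> \<le> card I" using assms by (rule card_image_le)
  finally show ?thesis .
qed

lemma balanced_blocks_volume:
  fixes p :: "'i \<Rightarrow> 'a::euclidean_space"
  assumes "balanced_blocks p A B k l"
  shows "measure lebesgue (sym_hull p (A \<union> B)) \<le>
    real (central_binomial k * central_binomial l) * measure lebesgue (convex hull (p ` (A \<union> B)))"
proof -
  interpret balanced_blocks p A B k l by fact
  show ?thesis
    unfolding of_nat_mult by (rule order_trans[OF sym_hull_le mult_left_mono[OF convex_hull_ge]]) simp
qed

text \<open>The value of \<open>M_Bus\<close> needs one body attaining the bound. The basis is split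
  into \<open>k\<close> and \<open>l\<close> vectors, and each part is completed by its negated sum,
  stored at the last index.\<close>

lemma balanced_blocks_exist:
  assumes kl: "k + l = DIM('a::euclidean_space)"
  shows "\<exists>p :: nat + nat \<Rightarrow> 'a. balanced_blocks p (Inl ` {..k}) (Inr ` {..l}) k l \<and>
    span (p ` (Inl ` {..k} \<union> Inr ` {..l})) = UNIV"
proof -
  obtain e :: "nat \<Rightarrow> 'a" where e: "bij_betw e {0..<DIM('a)} Basis"
    using ex_bij_betw_nat_finite[of "Basis :: 'a set"] by auto
  define p where "p = case_sum (\<lambda>i. if i < k then e i else - (\<Sum>j<k. e j))
     (\<lambda>i. if i < l then e (k + i) else - (\<Sum>j<l. e (k + j)))"
  have b: "balanced_blocks p (Inl ` {..k}) (Inr ` {..l}) k l"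
  proof
    show "(\<Sum>m\<in>Inl ` {..k}. p m) = 0" "(\<Sum>m\<in>Inr ` {..l}. p m) = 0"
      by (simp_all add: sum.reindex p_def lessThan_Suc_atMost[symmetric])
  qed (use kl in \<open>auto simp: card_image\<close>)
  have "Basis \<subseteq> p ` (Inl ` {..k} \<union> Inr ` {..l})"
  proof
    fix x :: 'a assume "x \<in> Basis"
    then obtain i where i: "i < DIM('a)" "x = e i"
      using e by (force simp: bij_betw_def)
    show "x \<in> p ` (Inl ` {..k} \<union> Inr ` {..l})"
    proof (cases "i < k")
      case True
      then have "x = p (Inl i)" using i by (simp add: p_def)
      with True show ?thesis by auto
    next
      case False
      then have "x = p (Inr (i - k))" "i - k \<le> l" using i kl by (auto simp: p_def)
      then show ?thesis by blast
    qed
  qed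
  then have "span (p ` (Inl ` {..k} \<union> Inr ` {..l})) = UNIV"
    using span_mono[of Basis] span_Basis by blast
  with b show ?thesis by blast
qed

lemma Bus_two_blocks:
  fixes p :: "'i \<Rightarrow> real ^ 'd"
  assumes d: "CARD('d) = 4 * m + r" "r \<le> 3"
    and blk: "balanced_blocks p A B (2 * m + 1) (2 * m + r - 1)" and span: "span (p ` (A \<union> B)) = UNIV"
  defines "C \<equiv> real (central_binomial (2 * m + 1) * central_binomial (2 * m + r - 1))"
  shows "mu_Bus (CARD('d) + 2) (sym_hull p (A \<union> B)) = kappa TYPE('d) / C"
    and "M_Bus (CARD('d) + 2) TYPE('d) = kappa TYPE('d) / C"
proof -
  interpret balanced_blocks p A B "2 * m + 1" "2 * m + r - 1" by (rule blk)
  have fin: "finite (A \<union> B)" using finite_blocks by simp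
  have "card (A \<union> B) = CARD('d) + 2"
    using card_blocks dim finite_blocks disjoint by (simp add: card_Un_disjoint)
  then have card: "card (vertices (convex hull (p ` (A \<union> B)))) \<le> CARD('d) + 2"
    using card_vertices_hull_image[OF fin, of p] by simp
  have sub: "convex hull (p ` (A \<union> B)) \<subseteq> sym_hull p (A \<union> B)"
    unfolding sym_hull_def by (intro hull_mono) auto
  have poly: "polytope (convex hull (p ` (A \<union> B)))"
    using fin unfolding polytope_def by (intro exI[of _ "p ` (A \<union> B)"]) simp
  have C: "C > 0" by (simp add: C_def)
  have bound: "C * measure lebesgue Q \<le> measure lebesgue K"
    if "K \<in> sym_convex_bodies" "polytope Q" "Q \<noteq> {}" "Q \<subseteq> K" "card (vertices Q) \<le> CARD('d) + 2"
    for K Q :: "(real ^ 'd) set"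
    unfolding C_def by (rule polytope_volume_bound_d_plus_2[OF that d])
  note ex = Bus_extremal[OF C bound
     sym_hull_in_sym_convex_bodies[OF fin span] poly sub card balanced_blocks_volume[OF blk, folded C_def]]
  show "mu_Bus (CARD('d) + 2) (sym_hull p (A \<union> B)) = kappa TYPE('d) / C" by (rule ex(1))
  show "M_Bus (CARD('d) + 2) TYPE('d) = kappa TYPE('d) / C" by (rule ex(2))
qed

text \<open>The origin is again adjoined as a one-point block. It is the mean of the given points,
  so neither hull changes, and its central binomial factor is 1.\<close>

lemma Bus_one_block:
  fixes p :: "'i \<Rightarrow> real ^ 'd"
  assumes A: "finite A" "card A = CARD('d) + 1" "(\<Sum>m\<in>A. p m) = 0" and span: "span (p ` A) = UNIV"
  defines "C \<equiv> real (central_binomial CARD('d))"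
  shows "mu_Bus (CARD('d) + 1) (sym_hull p A) = kappa TYPE('d) / C"
    and "M_Bus (CARD('d) + 1) TYPE('d) = kappa TYPE('d) / C"
proof -
  let ?q = "case_option 0 p"
  interpret balanced_blocks ?q "Some ` A" "{None}" "CARD('d)" 0
    by unfold_locales (use A in \<open>auto simp: card_image sum.reindex\<close>)
  have "0 = (\<Sum>m\<in>A. (1 / card A) *\<^sub>R p m)"
    using A(3) by (simp add: scaleR_sum_right[symmetric])
  also have "\<dots> \<in> convex hull (p ` A)"
    using A by (intro convex_sum) (auto intro!: hull_inc)
  finally have 0: "0 \<in> convex hull (p ` A)" .
  have q: "?q ` (Some ` A \<union> {None}) = insert 0 (p ` A)"
    by (auto simp: image_iff)
  have hull: "convex hull (?q ` (Some ` A \<union> {None})) = convex hull (p ` A)"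
    unfolding q using 0 by (simp add: hull_redundant)
  have "convex hull (p ` A) \<subseteq> sym_hull p A"
    unfolding sym_hull_def by (intro hull_mono) auto
  note sub = this
  have sym: "sym_hull ?q (Some ` A \<union> {None}) = sym_hull p A"
  proof -
    have "sym_hull ?q (Some ` A \<union> {None}) = convex hull (insert 0 (p ` A \<union> uminus ` p ` A))"
      unfolding sym_hull_def q by (rule arg_cong[of _ _ "(hull) convex"]) auto
    also have "\<dots> = sym_hull p A"
      using 0 sub by (auto simp: sym_hull_def hull_redundant)
    finally show ?thesis .
  qed
  have card: "card (vertices (convex hull (p ` A))) \<le> CARD('d) + 1"
    using card_vertices_hull_image[OF A(1), of p] A by simp
  have poly: "polytope (convex hull (p ` A))"
    using A unfolding polytope_def by (intro exI[of _ "p ` A"]) simp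
  have C: "C > 0" by (simp add: C_def)
  have vol: "measure lebesgue (sym_hull p A) \<le> C * measure lebesgue (convex hull (p ` A))"
    using balanced_blocks_volume[OF balanced_blocks_axioms] unfolding sym hull C_def by simp
  have bound: "C * measure lebesgue Q \<le> measure lebesgue K"
    if "K \<in> sym_convex_bodies" "polytope Q" "Q \<noteq> {}" "Q \<subseteq> K" "card (vertices Q) \<le> CARD('d) + 1"
    for K Q :: "(real ^ 'd) set"
    unfolding C_def by (rule polytope_volume_bound_d_plus_1[OF that])
  note ex = Bus_extremal[OF C bound
     sym_hull_in_sym_convex_bodies[OF A(1) span] poly sub card vol]
  show "mu_Bus (CARD('d) + 1) (sym_hull p A) = kappa TYPE('d) / C" by (rule ex(1))
  show "M_Bus (CARD('d) + 1) TYPE('d) = kappa TYPE('d) / C" by (rule ex(2))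
qed

lemma centered_regular_simplex:
  fixes S :: "'a::euclidean_space set"
  assumes "regular_simplex k S" "simplex_centroid S = 0"
  obtains C where "finite C" "card C = Suc k" "\<not> affine_dependent C" "S = convex hull C" "(\<Sum>v\<in>C. v) = 0"
proof -
  obtain C where C: "finite C" "\<not> affine_dependent C" "int (card C) = int k + 1" "S = convex hull C"
    using assms(1) by (auto simp: regular_simplex_def simplex)
  then have "vertices S = C"
    by (auto simp: vertices_def extreme_point_of_convex_hull_affine_independent)
  with assms(2) C have "(\<Sum>v\<in>C. v) = 0"
    by (auto simp: simplex_centroid_def)
  with C that show ?thesis by auto
qed

lemma dim_span_affine_independent:
  fixes C :: "'a::euclidean_space set"
  assumes "finite C" "card C = Suc k" "\<not> affine_dependent C"
  shows "k \<le> dim (span C)"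
proof -
  have "int k = aff_dim C"
    using assms aff_dim_affine_independent[of C] by simp
  also have "\<dots> \<le> aff_dim (span C)"
    by (intro aff_dim_subset span_superset)
  also have "\<dots> = int (dim (span C))"
    by (simp add: aff_dim_subspace)
  finally show ?thesis by simp
qed

lemma hull_of_hulls:
  fixes C1 C2 :: "'a::euclidean_space set"
  shows "convex hull (convex hull C1 \<union> convex hull C2) = convex hull (C1 \<union> C2)"
  by (rule hull_Un[symmetric]) (auto intro: convex_Inter)

lemma uminus_hull: "uminus ` (convex hull C) = convex hull (uminus ` (C :: 'a::euclidean_space set))"
  by (simp add: convex_hull_linear_image linear_uminus)

text \<open>The sum type keeps the index blocks disjoint whatever the two vertex sets are.
  Orthogonality makes their spans meet only in 0, and counting dimensions then shows that together
  they span the space.\<close>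

lemma orthogonal_simplices_blocks:
  fixes S1 S2 :: "'a::euclidean_space set"
  assumes S1: "regular_simplex k S1" "simplex_centroid S1 = 0"
    and S2: "regular_simplex l S2" "simplex_centroid S2 = 0"
    and orth: "in_orthogonal_subspaces S1 S2" and kl: "k + l = DIM('a)"
  shows "\<exists>(p :: 'a + 'a \<Rightarrow> 'a) A B. balanced_blocks p A B k l \<and> span (p ` (A \<union> B)) = UNIV \<and>
    convex hull (S1 \<union> S2 \<union> uminus ` S1 \<union> uminus ` S2) = sym_hull p (A \<union> B)"
proof -
  obtain C1 where C1: "finite C1" "card C1 = Suc k" "\<not> affine_dependent C1" "S1 = convex hull C1" "(\<Sum>v\<in>C1. v) = 0"
    using centered_regular_simplex[OF S1] by blast
  obtain C2 where C2: "finite C2" "card C2 = Suc l" "\<not> affine_dependent C2" "S2 = convex hull C2" "(\<Sum>v\<in>C2. v) = 0"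
    using centered_regular_simplex[OF S2] by blast
  let ?p = "case_sum id id :: 'a + 'a \<Rightarrow> 'a" and ?A = "Inl ` C1" and ?B = "Inr ` C2"
  have img: "?p ` (?A \<union> ?B) = C1 \<union> C2"
    by (auto simp: image_Un image_image)
  have "balanced_blocks ?p ?A ?B k l"
    by unfold_locales (use C1 C2 kl in \<open>auto simp: card_image sum.reindex\<close>)
  moreover have "span (C1 \<union> C2) = UNIV"
  proof -
    obtain U V where UV: "subspace U" "subspace V" "\<forall>u\<in>U. \<forall>v\<in>V. orthogonal u v" "S1 \<subseteq> U" "S2 \<subseteq> V"
      using orth by (auto simp: in_orthogonal_subspaces_def)
    have "C1 \<subseteq> U" "C2 \<subseteq> V"
      using UV C1(4) C2(4) hull_subset[of C1 convex] hull_subset[of C2 convex] by auto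
    then have sub: "span C1 \<subseteq> U" "span C2 \<subseteq> V"
      using UV by (auto intro: span_minimal[THEN subsetD])
    have "span C1 \<inter> span C2 = {0}"
    proof -
      have "x = 0" if "x \<in> span C1" "x \<in> span C2" for x
        using that sub UV(3) by (metis orthogonal_self subsetD)
      then show ?thesis using span_zero by blast
    qed
    then have "dim {x + y |x y. x \<in> span C1 \<and> y \<in> span C2} = dim (span C1) + dim (span C2)"
      using dim_sums_Int[of "span C1" "span C2"] by simp
    then have "DIM('a) \<le> dim {x + y |x y. x \<in> span C1 \<and> y \<in> span C2}"
      using dim_span_affine_independent[OF C1(1-3)] dim_span_affine_independent[OF C2(1-3)] kl by simp
    also have "\<dots> = dim (C1 \<union> C2)"
      by (simp only: span_Un[symmetric] dim_span)
    finally show ?thesis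
      using dim_eq_full[of "C1 \<union> C2"] dim_subset_UNIV[of "C1 \<union> C2"] by simp
  qed
  moreover have "convex hull (S1 \<union> S2 \<union> uminus ` S1 \<union> uminus ` S2) = sym_hull ?p (?A \<union> ?B)"
  proof -
    have "convex hull (S1 \<union> S2 \<union> uminus ` S1 \<union> uminus ` S2)
       = convex hull (convex hull (convex hull (convex hull C1 \<union> convex hull C2) \<union> convex hull (uminus ` C1)) \<union> convex hull (uminus ` C2))"
      unfolding C1(4) C2(4) uminus_hull
      by (metis (no_types) hull_of_hulls hull_hull)
    also have "\<dots> = convex hull (C1 \<union> C2 \<union> uminus ` C1 \<union> uminus ` C2)"
      by (simp only: hull_of_hulls)
    also have "\<dots> = sym_hull ?p (?A \<union> ?B)"
      unfolding sym_hull_def img by (simp add: image_Un Un_ac)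
    finally show ?thesis .
  qed
  ultimately show ?thesis
    unfolding img[symmetric] by blast
qed

lemma Bus_two_regular_simplices_body:
  fixes m r :: nat
  assumes d: "CARD('d::finite) = 4 * m + r" "r \<le> 3" "3 \<le> CARD('d)"
    and C: "C = real (central_binomial (2 * m + 1) * central_binomial (2 * m + r - 1))"
  shows "M_Bus (CARD('d) + 2) TYPE('d) = kappa TYPE('d) / C \<and>
      (\<forall>(B :: (real ^ 'd) set) S1 S2.
         regular_simplex (2 * m + 1) S1 \<and> simplex_centroid S1 = 0 \<and>
         regular_simplex (2 * m + r - 1) S2 \<and> simplex_centroid S2 = 0 \<and>
         in_orthogonal_subspaces S1 S2 \<and>
         B = convex hull (S1 \<union> S2 \<union> uminus ` S1 \<union> uminus ` S2) \<longrightarrow>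
         mu_Bus (CARD('d) + 2) B = M_Bus (CARD('d) + 2) TYPE('d))"
proof -
  have kl: "(2 * m + 1) + (2 * m + r - 1) = DIM(real ^ 'd)"
    using d by simp
  obtain p :: "nat + nat \<Rightarrow> real ^ 'd" and A B where "balanced_blocks p A B (2 * m + 1) (2 * m + r - 1)" "span (p ` (A \<union> B)) = UNIV"
    using balanced_blocks_exist[OF kl] by blast
  then have M: "M_Bus (CARD('d) + 2) TYPE('d) = kappa TYPE('d) / C"
    unfolding C by (rule Bus_two_blocks(2)[OF d(1,2)])
  have "mu_Bus (CARD('d) + 2) (convex hull (S1 \<union> S2 \<union> uminus ` S1 \<union> uminus ` S2)) = kappa TYPE('d) / C"
    if S: "regular_simplex (2 * m + 1) S1" "simplex_centroid S1 = 0" "regular_simplex (2 * m + r - 1) S2" "simplex_centroid S2 = 0"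
      "in_orthogonal_subspaces S1 S2" for S1 S2 :: "(real ^ 'd) set"
  proof -
    obtain p :: "(real ^ 'd) + (real ^ 'd) \<Rightarrow> real ^ 'd" and A B where
      p: "balanced_blocks p A B (2 * m + 1) (2 * m + r - 1)" "span (p ` (A \<union> B)) = UNIV"
      "convex hull (S1 \<union> S2 \<union> uminus ` S1 \<union> uminus ` S2) = sym_hull p (A \<union> B)"
      using orthogonal_simplices_blocks[OF S kl] by blast
    show ?thesis
      unfolding C p(3) by (rule Bus_two_blocks(1)[OF d(1,2) p(1,2)])
  qed
  with M show ?thesis by simp
qed

lemma Bus_regular_simplex_body:
  "M_Bus (CARD('d) + 1) TYPE('d::finite) = kappa TYPE('d) / real (central_binomial CARD('d)) \<and>
      (\<forall>(B :: (real ^ 'd) set) S.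
         regular_simplex CARD('d) S \<and> simplex_centroid S = 0 \<and>
         B = convex hull (S \<union> uminus ` S) \<longrightarrow>
         mu_Bus (CARD('d) + 1) B = M_Bus (CARD('d) + 1) TYPE('d))"
proof -
  have "CARD('d) + 0 = DIM(real ^ 'd)" by simp
  from balanced_blocks_exist[OF this]
  obtain p :: "nat + nat \<Rightarrow> real ^ 'd" where
    p: "balanced_blocks p (Inl ` {..CARD('d)}) (Inr ` {..0}) CARD('d) 0"
      "span (p ` (Inl ` {..CARD('d)} \<union> Inr ` {..0})) = UNIV"
    by blast
  interpret balanced_blocks p "Inl ` {..CARD('d)}" "Inr ` {..0}" "CARD('d)" 0 by (rule p(1))
  \<comment> \<open>A one-point block with vanishing sum is the origin, so removing it preserves the
    span.\<close>
  have "p (Inr 0) = 0"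
    using balanced(2) by simp
  then have "span (p ` Inl ` {..CARD('d)}) = UNIV"
    using p(2) by (simp add: image_Un span_insert_0)
  then have M: "M_Bus (CARD('d) + 1) TYPE('d) = kappa TYPE('d) / real (central_binomial CARD('d))"
    using Bus_one_block(2)[OF finite_blocks(1) _ balanced(1)] card_blocks(1) by simp
  have "mu_Bus (CARD('d) + 1) (convex hull (S \<union> uminus ` S)) = kappa TYPE('d) / real (central_binomial CARD('d))"
    if S: "regular_simplex CARD('d) S" "simplex_centroid S = 0" for S :: "(real ^ 'd) set"
  proof -
    obtain C where C: "finite C" "card C = Suc CARD('d)" "\<not> affine_dependent C" "S = convex hull C" "(\<Sum>v\<in>C. v) = 0"
      using centered_regular_simplex[OF S] by blast
    have "convex hull (S \<union> uminus ` S) = sym_hull id C"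
      by (simp add: C(4) uminus_hull hull_of_hulls sym_hull_def)
    moreover have "span C = UNIV"
    proof -
      have "affine hull C = UNIV"
        using affine_independent_span_eq[OF C(3)] C(2) by simp
      then show ?thesis
        using affine_hull_subset_span[of C] by auto
    qed
    ultimately show ?thesis
      using Bus_one_block(1)[of C id] C by simp
  qed
  with M show ?thesis by simp
qed

theorem theorem3p4:
  fixes d m r :: nat
  assumes "CARD('d::finite) = d" and "3 \<le> d" and "d = 4 * m + r" and "r \<le> 3"
  shows
    "(M_Bus (d + 1) TYPE('d) = kappa TYPE('d) / real (d choose (d div 2)) \<and>
      (\<forall>(B :: (real ^ 'd) set) S.
         regular_simplex d S \<and> simplex_centroid S = 0 \<and>
         B = convex hull (S \<union> uminus ` S) \<longrightarrow>
         mu_Bus (d + 1) B = M_Bus (d + 1) TYPE('d))) \<and>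
     (r \<le> 1 \<longrightarrow>
      M_Bus (d + 2) TYPE('d) =
        kappa TYPE('d) / (real ((2 * m + 1) choose m) * real ((2 * m + r - 1) choose m)) \<and>
      (\<forall>(B :: (real ^ 'd) set) S1 S2.
         regular_simplex (2 * m + 1) S1 \<and> simplex_centroid S1 = 0 \<and>
         regular_simplex (2 * m + r - 1) S2 \<and> simplex_centroid S2 = 0 \<and>
         in_orthogonal_subspaces S1 S2 \<and>
         B = convex hull (S1 \<union> S2 \<union> uminus ` S1 \<union> uminus ` S2) \<longrightarrow>
         mu_Bus (d + 2) B = M_Bus (d + 2) TYPE('d))) \<and>
     (2 \<le> r \<longrightarrow>
      M_Bus (d + 2) TYPE('d) =
        kappa TYPE('d) / (real ((2 * m + 1) choose m) * real ((2 * m + r - 1) choose (m + 1))) \<and>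
      (\<forall>(B :: (real ^ 'd) set) S1 S2.
         regular_simplex (2 * m + 1) S1 \<and> simplex_centroid S1 = 0 \<and>
         regular_simplex (2 * m + r - 1) S2 \<and> simplex_centroid S2 = 0 \<and>
         in_orthogonal_subspaces S1 S2 \<and>
         B = convex hull (S1 \<union> S2 \<union> uminus ` S1 \<union> uminus ` S2) \<longrightarrow>
         mu_Bus (d + 2) B = M_Bus (d + 2) TYPE('d)))"
proof -
  have C1: "central_binomial (2 * m + 1) = (2 * m + 1) choose m"
    by simp
  \<comment> \<open>For \<open>r = 0\<close> the upper index is odd and its half rounds down to
    \<open>m - 1\<close>; symmetry of binomial coefficients turns this into the stated
    \<open>m\<close>. For \<open>r = 2\<close> below, it likewise turns \<open>m\<close> into
    \<open>m + 1\<close>.\<close>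
  have C2: "central_binomial (2 * m + r - 1) = (2 * m + r - 1) choose m" if "r \<le> 1"
  proof (cases "r = 0")
    case True
    with assms have "m - 1 + 1 = m" by simp
    moreover from this True have "(2 * m + r - 1) div 2 = m - 1" "2 * m + r - 1 - m = m - 1" by linarith+
    ultimately show ?thesis
      using binomial_symmetric[of m "2 * m + r - 1"] True by simp
  next
    case False
    with that have "r = 1" by simp
    then show ?thesis by simp
  qed
  have C3: "central_binomial (2 * m + r - 1) = (2 * m + r - 1) choose (m + 1)" if "2 \<le> r"
  proof (cases "r = 2")
    case True
    then show ?thesis
      using binomial_symmetric[of m "2 * m + 1"] by simp
  next
    case False
    with that assms have "r = 3" by simp
    then show ?thesis by simp
  qed
  have d: "CARD('d) = 4 * m + r" "3 \<le> CARD('d)"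
    using assms by simp_all
  note two = Bus_two_regular_simplices_body[where 'd='d, OF d(1) assms(4) d(2), unfolded assms(1)]
  show ?thesis
    by (intro conjI[OF Bus_regular_simplex_body[where 'd='d, unfolded assms(1)] conjI[OF impI impI]];
        rule two; simp only: C1 C2 C3 of_nat_mult)
qed

end
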